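(* Let $\alpha,\beta$ be integers with $\beta\neq 1$, $\alpha\equiv 7\pmod 9$ and $\beta\equiv 1\pmod 9$, and let $n=v_3(\beta-1)$. Then $|G_3|=3^{n+4}$, the nilpotency class of $G_3$ is $3$, $o(a)=9$, $o(b)=3^{n+1}$ and $o(c)=3$.
   Context: $G(\alpha,\beta)=\langle A,B\mid A^{[A,B]}=A^{\alpha},\ B^{[B,A]}=B^{\beta}\rangle$ with $[x,y]=x^{-1}y^{-1}xy$, $y^x=x^{-1}yx$, and $C=[A,B]$. The group $G(\alpha,\beta)$ is finite and nilpotent, hence the direct product of its Sylow subgroups; $G_3$ denotes its Sylow $3$-subgroup and $a,b,c$ denote the images of $A,B,C$ under the canonical projection $G(\alpha,\beta)\to G_3$. $v_3$ is the $3$-adic valuation and $o(x)$ the order of $x$. *)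

theory Defs
  imports "HOL-Algebra.Algebra" "HOL-Computational_Algebra.Factorial_Ring"
begin

text \<open>Letters: (g, e) with g = False for A, g = True for B; e = True means inverse.\<close>
type_synonym letter = "bool \<times> bool"

definition linv :: "letter \<Rightarrow> letter" where
  "linv x = (fst x, \<not> snd x)"

definition winv :: "letter list \<Rightarrow> letter list" where
  "winv w = rev (map linv w)"

definition wpow :: "letter list \<Rightarrow> int \<Rightarrow> letter list" where
  "wpow w k = (if k \<ge> 0 then concat (replicate (nat k) w)
               else concat (replicate (nat (- k)) (winv w)))"

definition wA :: "letter list" where "wA = [(False, False)]"
definition wB :: "letter list" where "wB = [(True, False)]"
definition wC :: "letter list" where "wC = winv wA @ winv wB @ wA @ wB"

text \<open>Congruence on words generated by free cancellation and the two defining relations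
  A^[A,B] = A^alpha, i.e. C^-1 A C = A^alpha, and B^[B,A] = B^beta, i.e. C B C^-1 = B^beta
  (since [B,A] = C^-1).\<close>
inductive weq :: "int \<Rightarrow> int \<Rightarrow> letter list \<Rightarrow> letter list \<Rightarrow> bool" for \<alpha> \<beta> where
  rel1: "weq \<alpha> \<beta> (winv wC @ wA @ wC) (wpow wA \<alpha>)"
| rel2: "weq \<alpha> \<beta> (wC @ wB @ winv wC) (wpow wB \<beta>)"
| cancel: "weq \<alpha> \<beta> [x, linv x] []"
| refl: "weq \<alpha> \<beta> w w"
| sym: "weq \<alpha> \<beta> u v \<Longrightarrow> weq \<alpha> \<beta> v u"
| trans: "weq \<alpha> \<beta> u v \<Longrightarrow> weq \<alpha> \<beta> v w \<Longrightarrow> weq \<alpha> \<beta> u w"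
| ctxt: "weq \<alpha> \<beta> u v \<Longrightarrow> weq \<alpha> \<beta> (p @ u @ q) (p @ v @ q)"

definition wclass :: "int \<Rightarrow> int \<Rightarrow> letter list \<Rightarrow> letter list set" where
  "wclass \<alpha> \<beta> w = {v. weq \<alpha> \<beta> w v}"

definition wmult :: "int \<Rightarrow> int \<Rightarrow> letter list set \<Rightarrow> letter list set \<Rightarrow> letter list set" where
  "wmult \<alpha> \<beta> U V = {v. \<exists>x\<in>U. \<exists>y\<in>V. weq \<alpha> \<beta> (x @ y) v}"

definition presG :: "int \<Rightarrow> int \<Rightarrow> letter list set monoid" where
  "presG \<alpha> \<beta> = \<lparr> carrier = range (wclass \<alpha> \<beta>),
     monoid.mult = wmult \<alpha> \<beta>, one = wclass \<alpha> \<beta> [] \<rparr>"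

text \<open>In a finite nilpotent group the Sylow p-subgroup is the set of p-elements.\<close>
definition pelems :: "nat \<Rightarrow> ('a, 'b) monoid_scheme \<Rightarrow> 'a set" where
  "pelems p G = {g \<in> carrier G. \<exists>k. group.ord G g = p ^ k}"

text \<open>The p-part of g: the unique p-element x commuting with a p'-element y with g = x y.
  In a finite nilpotent group this is the canonical projection onto the Sylow p-subgroup.\<close>
definition ppart :: "nat \<Rightarrow> ('a, 'b) monoid_scheme \<Rightarrow> 'a \<Rightarrow> 'a" where
  "ppart p G g = (THE x. x \<in> carrier G \<and> (\<exists>k. group.ord G x = p ^ k) \<and>
      (\<exists>y \<in> carrier G. coprime (group.ord G y) p \<and> x \<otimes>\<^bsub>G\<^esub> y = g
                     \<and> x \<otimes>\<^bsub>G\<^esub> y = y \<otimes>\<^bsub>G\<^esub> x))"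

definition commsub :: "('a, 'b) monoid_scheme \<Rightarrow> 'a set \<Rightarrow> 'a set \<Rightarrow> 'a set" where
  "commsub G U V = generate G {inv\<^bsub>G\<^esub> x \<otimes>\<^bsub>G\<^esub> inv\<^bsub>G\<^esub> y \<otimes>\<^bsub>G\<^esub> x \<otimes>\<^bsub>G\<^esub> y | x y. x \<in> U \<and> y \<in> V}"

text \<open>Lower central series, 0-indexed: lcs G 0 = G = gamma_1, lcs G (Suc i) = [lcs G i, G].\<close>
fun lcs :: "('a, 'b) monoid_scheme \<Rightarrow> nat \<Rightarrow> 'a set" where
  "lcs G 0 = carrier G"
| "lcs G (Suc i) = commsub G (lcs G i) (carrier G)"

definition nilpotency_class_is :: "('a, 'b) monoid_scheme \<Rightarrow> nat \<Rightarrow> bool" where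
  "nilpotency_class_is G c \<longleftrightarrow> lcs G c = {\<one>\<^bsub>G\<^esub>} \<and> (\<forall>i<c. lcs G i \<noteq> {\<one>\<^bsub>G\<^esub>})"

end

theory Submission
  imports Defs "HOL-Number_Theory.Residues"
begin

text \<open>
  \<^bold>\<open>Finiteness.\<close> The relations give \<open>A\<^bsup>C^2\<^esup> = A\<^bsup>\<alpha>^2\<^esup>\<close>. Conjugating by \<open>B\<close> exhibits a non-zero power
  of \<open>B\<close> as a product \<open>C\<^sup>k A\<^sup>x C\<^sup>l\<close>; its commutator with \<open>C\<close> shows that some power of \<open>B\<close> is a power
  of \<open>A\<close>, hence central, hence of finite order. Then \<open>C\<close> and \<open>A\<close> have finite order as well.

  \<^bold>\<open>Nilpotency.\<close> Every prime dividing the order of \<open>A\<close> divides \<open>\<alpha> - 1\<close>: if \<open>q\<close> is the largest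
  exception, some power \<open>A\<^sup>k\<close> of order \<open>q\<close> is conjugate to \<open>C\<^sup>k\<close>, and then \<open>A\<^bsup>k(\<alpha>-1)\<^esup>\<close> lies in
  \<open>\<langle>B\<rangle>\<close>, so it is central and killed by \<open>\<alpha> - 1\<close>. Consequently adjoining \<open>C\<^sup>k\<close>, \<open>A\<^sup>k\<close>, \<open>B\<^sup>k\<close>
  successively to a normal subgroup containing the \<open>kp\<close>-th powers of the generators gives normal
  subgroups, and along such chains one finds a normal \<open>p\<close>-subgroup and a normal \<open>p'\<close>-subgroup which
  together generate the group and commute elementwise.

  \<^bold>\<open>Upper bound.\<close> In the \<open>3\<close>-part, the same conjugated relation reads \<open>b\<^sup>y = a\<^sup>z c\<^sup>w\<close> with
  \<open>3\<^bsup>2n\<^esup> | y\<close>, \<open>27 | z\<close> and \<open>w\<close> exactly divisible by \<open>3\<close>. Comparing its commutators with \<open>a\<close>, \<open>b\<close>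
  and \<open>c\<close> forces \<open>a\<^sup>9 = b\<^bsup>3^(n+1)\<^esup> = c\<^sup>3 = 1\<close>, so all elements have the form \<open>a\<^sup>i b\<^sup>j c\<^sup>k\<close>.

  \<^bold>\<open>Lower bound.\<close> The multiplication of such normal forms is a group structure on the triples
  \<open>(i, j, k)\<close> modulo \<open>9\<close>, \<open>3\<^bsup>n+1\<^esup>\<close>, \<open>3\<close>; it satisfies the defining relations, so the
  \<open>3\<close>-part maps onto it.
\<close>

hide_const (open) Divisibility.prime

section \<open>Geometric sums\<close>

definition geom_sum :: "'a::comm_ring_1 \<Rightarrow> nat \<Rightarrow> 'a" where
  "geom_sum t k = (\<Sum>i<k. t ^ i)"

lemma geom_sum_0 [simp]: "geom_sum t 0 = 0"
  by (simp add: geom_sum_def)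

lemma geom_sum_Suc: "geom_sum t (Suc k) = geom_sum t k + t ^ k"
  by (simp add: geom_sum_def)

lemma geom_sum_Suc_shift: "geom_sum t (Suc k) = 1 + t * geom_sum t k"
  by (simp add: geom_sum_def sum.lessThan_Suc_shift sum_distrib_left del: sum.lessThan_Suc)

lemma minus_one_times_geom_sum: "(t - 1) * geom_sum t k = t ^ k - 1"
  by (simp add: geom_sum_def power_diff_1_eq)

lemma minus_one_dvd_power_minus_one: "t - 1 dvd t ^ k - (1 :: 'a::comm_ring_1)"
  by (metis minus_one_times_geom_sum dvd_triv_left)

lemma geom_sum_add: "geom_sum t (k + l) = geom_sum t k + t ^ k * geom_sum t l"
  by (induction l) (simp_all add: geom_sum_Suc algebra_simps power_add)

lemma geom_sum_mult: "geom_sum t (k * l) = geom_sum t k * geom_sum (t ^ k) l"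
proof (induction l)
  case (Suc l)
  have "geom_sum t (k * Suc l) = geom_sum t (k * l + k)" by (simp add: add.commute)
  then show ?case by (simp only: geom_sum_add Suc geom_sum_Suc power_mult) (simp add: algebra_simps)
qed simp

lemma minus_one_dvd_geom_sum_minus: "t - 1 dvd geom_sum t k - of_nat k"
proof (induction k)
  case (Suc k)
  then have "t - 1 dvd (geom_sum t k - of_nat k) + (t ^ k - 1)"
    by (intro dvd_add minus_one_dvd_power_minus_one)
  then show ?case by (simp add: geom_sum_Suc algebra_simps)
qed simp

lemma minus_one_squared_dvd_geom_sum_minus:
  "(t - 1)\<^sup>2 dvd geom_sum t k - of_nat k - of_nat (k choose 2) * (t - 1)"
proof (induction k)
  case (Suc k)
  have "(t - 1) * (t - 1) dvd (t - 1) * (geom_sum t k - of_nat k)"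
    by (intro mult_dvd_mono minus_one_dvd_geom_sum_minus) simp
  moreover have "(t - 1) * (geom_sum t k - of_nat k) = t ^ k - 1 - of_nat k * (t - 1)"
    using minus_one_times_geom_sum[of t k] by (simp add: algebra_simps)
  ultimately have "(t - 1)\<^sup>2 dvd t ^ k - 1 - of_nat k * (t - 1)"
    by (simp only: power2_eq_square)
  then have "(t - 1)\<^sup>2 dvd (geom_sum t k - of_nat k - of_nat (k choose 2) * (t - 1))
      + (t ^ k - 1 - of_nat k * (t - 1))"
    by (intro dvd_add Suc)
  moreover have "Suc k choose 2 = k + (k choose 2)" by (simp add: numeral_2_eq_2)
  ultimately show ?case by (simp add: geom_sum_Suc algebra_simps)
qed (simp add: numeral_2_eq_2)

lemma odd_dvd_choose_two:
  assumes "odd q"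
  shows "q dvd q choose 2"
proof -
  obtain l where "q = 2 * l + 1" using assms by (elim oddE)
  then have "q choose 2 = q * l" by (simp add: choose_two)
  then show ?thesis by simp
qed

lemma odd_power_dvd_geom_sum_minus_self:
  fixes t :: int
  assumes "odd q" and t: "int q ^ n dvd t - 1" and "n \<ge> 1"
  shows "int q ^ Suc n dvd geom_sum t q - int q"
proof -
  have "int q * int q ^ n dvd int (q choose 2) * (t - 1)"
    using odd_dvd_choose_two[OF \<open>odd q\<close>] t by (intro mult_dvd_mono) simp_all
  moreover have "int q ^ Suc n dvd geom_sum t q - int q - int (q choose 2) * (t - 1)"
  proof -
    have "int q ^ Suc n dvd (int q ^ n)\<^sup>2"
      using \<open>n \<ge> 1\<close> unfolding power_mult[symmetric] by (intro le_imp_power_dvd) simp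
    also have "\<dots> dvd (t - 1)\<^sup>2" using t by (rule dvd_power_same)
    also have "\<dots> dvd geom_sum t q - int q - int (q choose 2) * (t - 1)"
      by (rule minus_one_squared_dvd_geom_sum_minus)
    finally show ?thesis .
  qed
  ultimately have "int q ^ Suc n dvd
      (geom_sum t q - int q - int (q choose 2) * (t - 1)) + int (q choose 2) * (t - 1)"
    by (intro dvd_add) simp_all
  then show ?thesis by simp
qed

lemma odd_power_dvd_geom_sum_minus:
  fixes t :: int
  assumes q: "odd q" and t: "int q ^ n dvd t - 1" and n: "n \<ge> 1" and "q ^ m dvd k"
  shows "int q ^ (n + m) dvd geom_sum t k - int k"
  using assms(4)
proof (induction m arbitrary: k)
  case 0
  then show ?case using dvd_trans[OF t minus_one_dvd_geom_sum_minus[of t k]] by simp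
next
  case (Suc m)
  then obtain l where k: "k = l * q" and l: "q ^ m dvd l"
    by (metis dvd_def mult.assoc mult.commute power_Suc)
  have IH: "int q ^ (n + m) dvd geom_sum t l - int l" using l by (rule Suc.IH)
  have "int q ^ m dvd int l" using l by (simp flip: of_nat_power)
  moreover have "int q ^ m dvd geom_sum t l - int l"
    using IH unfolding power_add by (rule dvd_mult_right)
  ultimately have "int q ^ m dvd int l + (geom_sum t l - int l)" by (intro dvd_add)
  then have "int q ^ (n + m) dvd t ^ l - 1"
    unfolding power_add minus_one_times_geom_sum[symmetric] by (intro mult_dvd_mono t) simp
  then have "int q ^ Suc (n + m) dvd geom_sum (t ^ l) q - int q"
    using q n by (intro odd_power_dvd_geom_sum_minus_self) simp_all
  then have "int q ^ Suc (n + m) dvd geom_sum t l * (geom_sum (t ^ l) q - int q)"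
    by (rule dvd_mult)
  moreover have "int q ^ Suc (n + m) dvd int q * (geom_sum t l - int l)"
    unfolding power_Suc using IH by (intro mult_dvd_mono) simp_all
  ultimately have "int q ^ Suc (n + m) dvd
      geom_sum t l * (geom_sum (t ^ l) q - int q) + int q * (geom_sum t l - int l)"
    by (rule dvd_add)
  then show ?case by (simp add: k geom_sum_mult algebra_simps)
qed

lemma odd_power_dvd_relation_exponent:
  fixes t :: int
  assumes q: "odd q" and t: "int q ^ n dvd t - 1" and n: "n \<ge> 1" and k: "q ^ m dvd k"
  shows "int q ^ (n + m) dvd int k * t ^ l - t * geom_sum t k"
proof -
  have "int q ^ n dvd (t ^ l - 1) - (t - 1)"
    using dvd_trans[OF t minus_one_dvd_power_minus_one] t by (rule dvd_diff)
  moreover have "int q ^ m dvd int k" using k by (simp flip: of_nat_power)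
  ultimately have "int q ^ (n + m) dvd (t ^ l - t) * int k"
    unfolding power_add by (intro mult_dvd_mono) simp_all
  moreover have "int q ^ (n + m) dvd t * (geom_sum t k - int k)"
    using odd_power_dvd_geom_sum_minus[OF assms] by (rule dvd_mult)
  ultimately have "int q ^ (n + m) dvd (t ^ l - t) * int k - t * (geom_sum t k - int k)"
    by (rule dvd_diff)
  then show ?thesis by (simp add: algebra_simps)
qed

lemma lifting_the_exponent:
  fixes t :: int
  assumes p: "prime p" "odd p" and t: "t - 1 = int p ^ n * v" "\<not> int p dvd v" and n: "n \<ge> 1"
    and k: "k = p ^ m * l" "\<not> p dvd l"
  obtains r where "t ^ k - 1 = int p ^ (n + m) * r" "\<not> int p dvd r"
proof -
  have "int p ^ (n + m) dvd geom_sum t k - int k"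
    using p(2) t(1) n k(1) by (intro odd_power_dvd_geom_sum_minus) simp_all
  then obtain d where "geom_sum t k = int k + int p ^ (n + m) * d"
    by (metis dvdE diff_eq_eq add.commute)
  then have geom: "geom_sum t k = int p ^ m * (int l + int p ^ n * d)"
    by (simp add: k(1) power_add algebra_simps)
  have "int p dvd int p ^ n * d" using n by (simp add: dvd_power)
  then have "\<not> int p dvd int l + int p ^ n * d"
    using k(2) by (simp add: dvd_add_left_iff)
  then have "\<not> int p dvd v * (int l + int p ^ n * d)"
    using p(1) t(2) by (simp add: prime_dvd_mult_iff)
  moreover have "t ^ k - 1 = int p ^ (n + m) * (v * (int l + int p ^ n * d))"
    by (simp add: minus_one_times_geom_sum[symmetric] geom t(1) power_add algebra_simps)
  ultimately show ?thesis using that by blast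
qed

lemma dvd_geom_sum:
  fixes t :: int
  assumes "d dvd k" "d > 0" "\<And>p. prime p \<Longrightarrow> p dvd d \<Longrightarrow> int p dvd t - 1"
  shows "int d dvd geom_sum t k"
  using assms
proof (induction d arbitrary: k rule: less_induct)
  case (less d)
  show ?case
  proof (cases "d = 1")
    case False
    then obtain p e where p: "prime p" and d: "d = p * e"
      using prime_factor_nat by (metis dvdE)
    obtain l where k: "k = (e * l) * p"
      using less.prems(1) d by (metis dvdE mult.assoc mult.commute)
    have "int e dvd geom_sum t (e * l)"
      by (rule less.IH) (use less.prems(2,3) d prime_gt_1_nat[OF p] in auto)
    moreover have "int p dvd geom_sum (t ^ (e * l)) p"
    proof -
      have "int p dvd t ^ (e * l) - 1"
        using less.prems(3)[OF p] d minus_one_dvd_power_minus_one by (meson dvd_trans dvd_triv_left)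
      then have "int p dvd geom_sum (t ^ (e * l)) p - int p"
        using minus_one_dvd_geom_sum_minus[of "t ^ (e * l)" p] by (rule dvd_trans)
      then show ?thesis using dvd_add[OF _ dvd_refl] by fastforce
    qed
    ultimately show ?thesis
      unfolding k geom_sum_mult d mult.commute[of p] of_nat_mult by (rule mult_dvd_mono)
  qed simp
qed

lemma cong_7_mod_9_imp_cube_mod_27:
  fixes t :: int
  assumes "t mod 9 = 7"
  shows "[t ^ 3 = 19] (mod 27)" "[t ^ 9 = 1] (mod 27)"
proof -
  obtain s where "t = 7 + 9 * s" using assms by (metis mod_mult_div_eq add.commute)
  then have "t ^ 3 - 19 = 27 * (12 + 49 * s + 63 * s\<^sup>2 + 27 * s ^ 3)"
    by (simp add: power3_eq_cube power2_eq_square algebra_simps)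
  then show cube: "[t ^ 3 = 19] (mod 27)" by (simp add: cong_iff_dvd_diff)
  have "[(t ^ 3) ^ 3 = 19 ^ 3] (mod 27)" by (intro cong_pow cube)
  then show "[t ^ 9 = 1] (mod 27)" by (simp add: cong_def flip: power_mult)
qed

lemma cong_geom_sum_mod_27:
  fixes t :: int
  assumes "t mod 9 = 7"
  shows "[geom_sum t (7 + 9 * s) = 10 + 20 * (1 + t + t\<^sup>2) + 9 * int s] (mod 27)"
proof -
  note pow = cong_7_mod_9_imp_cube_mod_27[OF assms]
  have dvd_minus_one: "int 3 ^ 1 dvd t - 1" using assms by simp presburger
  have "int 3 ^ (1 + 2) dvd geom_sum t (9 * s) - int (9 * s)"
    by (rule odd_power_dvd_geom_sum_minus[OF _ dvd_minus_one]) simp_all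
  then have tail: "[geom_sum t (9 * s) = 9 * int s] (mod 27)" by (simp add: cong_iff_dvd_diff)
  have "[t ^ 7 * geom_sum t (9 * s) = t ^ 7 * (9 * int s)] (mod 27)"
    by (intro cong_mult tail cong_refl)
  moreover have "[t ^ 7 * (9 * int s) = 9 * int s] (mod 27)"
  proof -
    have "3 dvd t ^ 7 - 1"
      using dvd_minus_one minus_one_dvd_power_minus_one[of t 7] dvd_trans by auto
    then have "27 dvd (t ^ 7 - 1) * (9 * int s)"
      using mult_dvd_mono[of 3 "t ^ 7 - 1" 9 "9 * int s"] by simp
    then show ?thesis by (simp add: cong_iff_dvd_diff algebra_simps)
  qed
  ultimately have shift: "[t ^ 7 * geom_sum t (9 * s) = 9 * int s] (mod 27)" by (rule cong_trans)
  have "geom_sum t 7 = (t ^ 3)\<^sup>2 + t ^ 3 * (1 + t + t\<^sup>2) + (1 + t + t\<^sup>2)"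
    by (simp add: geom_sum_def eval_nat_numeral algebra_simps)
  also have "[\<dots> = 19\<^sup>2 + 19 * (1 + t + t\<^sup>2) + (1 + t + t\<^sup>2)] (mod 27)"
    by (intro cong_add cong_mult cong_pow pow cong_refl)
  finally have "[geom_sum t 7 + t ^ 7 * geom_sum t (9 * s)
      = 19\<^sup>2 + 19 * (1 + t + t\<^sup>2) + (1 + t + t\<^sup>2) + 9 * int s] (mod 27)"
    by (intro cong_add shift)
  moreover have "[19\<^sup>2 + 19 * (1 + t + t\<^sup>2) + (1 + t + t\<^sup>2) + 9 * int s
      = 10 + 20 * (1 + t + t\<^sup>2) + 9 * int s] (mod 27)"
    by (simp add: cong_iff_dvd_diff algebra_simps)
  ultimately show ?thesis unfolding geom_sum_add by (rule cong_trans)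
qed

lemma dvd_27_relation_exponent:
  fixes t :: nat
  assumes "int t mod 9 = 7"
  shows "27 dvd int t * geom_sum (int t) t - int t ^ (t + 1)"
proof -
  have "t mod 9 = 7" using assms zmod_int[of t 9] by simp
  then obtain s where t: "t = 7 + 9 * s" by (metis mod_mult_div_eq add.commute)
  define u where "u = int t"
  have u: "u mod 9 = 7" "u = 7 + 9 * int s" by (simp_all add: u_def t)
  note pow = cong_7_mod_9_imp_cube_mod_27[OF u(1)]
  have "u ^ (t + 1) = (u ^ 3)\<^sup>2 * u\<^sup>2 * (u ^ 9) ^ s"
    by (simp add: t power_add power_mult flip: power_mult)
  also have "[\<dots> = 19\<^sup>2 * u\<^sup>2 * 1 ^ s] (mod 27)" by (intro cong_mult cong_pow pow cong_refl)
  finally have power: "[u ^ (t + 1) = 19\<^sup>2 * u\<^sup>2] (mod 27)" by simp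
  have "[u * geom_sum u t - u ^ (t + 1)
      = u * (10 + 20 * (1 + u + u\<^sup>2) + 9 * int s) - 19\<^sup>2 * u\<^sup>2] (mod 27)"
    unfolding t by (intro cong_diff cong_mult cong_refl cong_geom_sum_mod_27 u(1) power[unfolded t])
  moreover have "u * (10 + 20 * (1 + u + u\<^sup>2) + 9 * int s) - 19\<^sup>2 * u\<^sup>2
      = 27 * (- 357 - 599 * int s + 240 * (int s)\<^sup>2 + 540 * int s ^ 3)"
    by (simp add: u(2) power2_eq_square power3_eq_cube algebra_simps)
  ultimately show ?thesis by (simp add: u_def cong_def mod_eq_0_iff_dvd)
qed

section \<open>Commutators and the Macdonald relations\<close>

context group
begin

lemma inv_mult_cancel_left [simp]:
  assumes "x \<in> carrier G" "y \<in> carrier G"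
  shows "inv x \<otimes> (x \<otimes> y) = y" "x \<otimes> (inv x \<otimes> y) = y"
  using assms by (simp_all add: m_assoc[symmetric])

lemma int_pow_mult_left:
  "x \<in> carrier G \<Longrightarrow> y \<in> carrier G \<Longrightarrow>
    x [^] (i::int) \<otimes> (x [^] (j::int) \<otimes> y) = x [^] (i + j) \<otimes> y"
  by (simp add: int_pow_mult m_assoc)

lemma int_pow_Suc:
  assumes "x \<in> carrier G"
  shows "x [^] int (Suc k) = x [^] int k \<otimes> x" "x [^] int (Suc k) = x \<otimes> x [^] int k"
  using assms int_pow_mult[of x "int k" 1] int_pow_mult[of x 1 "int k"]
  by (simp_all add: add.commute)

lemma int_pow_conj:
  assumes [simp]: "x \<in> carrier G" "y \<in> carrier G" "z \<in> carrier G" and eq: "x \<otimes> y = y \<otimes> z"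
  shows "x [^] (k::int) \<otimes> y = y \<otimes> z [^] k"
proof -
  have nat: "x [^] (n::nat) \<otimes> y = y \<otimes> z [^] n" for n
  proof (induction n)
    case (Suc n)
    have "x [^] Suc n \<otimes> y = x [^] n \<otimes> (y \<otimes> z)"
      by (simp add: m_assoc eq)
    also have "\<dots> = y \<otimes> z [^] Suc n"
      by (simp add: m_assoc[symmetric] Suc)
    finally show ?case .
  qed simp
  show ?thesis
  proof (cases k rule: int_cases4)
    case (nonneg n)
    then show ?thesis using nat by (simp add: int_pow_int)
  next
    case (neg n)
    have "inv (x [^] n) \<otimes> (x [^] n \<otimes> y) \<otimes> inv (z [^] n)
        = inv (x [^] n) \<otimes> (y \<otimes> z [^] n) \<otimes> inv (z [^] n)"
      by (simp only: nat)
    then show ?thesis using neg by (simp add: m_assoc int_pow_neg_int)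
  qed
qed

lemma int_pow_commute:
  assumes "x \<in> carrier G" "y \<in> carrier G" "x \<otimes> y = y \<otimes> x"
  shows "x [^] (k::int) \<otimes> y = y \<otimes> x [^] k"
  using assms by (intro int_pow_conj) simp_all

lemma int_pow_commute_self:
  assumes "x \<in> carrier G"
  shows "x [^] (k::int) \<otimes> x = x \<otimes> x [^] k"
  using assms by (intro int_pow_commute) simp_all

lemma int_pow_cong:
  assumes "x \<in> carrier G" "x [^] (m::int) = \<one>" "[i = j] (mod m)"
  shows "x [^] i = x [^] j"
proof -
  obtain l where "i = j + m * l" using assms(3) by (metis cong_iff_lin cong_sym)
  then show ?thesis using assms by (simp add: int_pow_mult int_pow_pow[symmetric])
qed

lemma int_pow_eq_one_mono:
  fixes m k :: int
  assumes "x \<in> carrier G" "x [^] m = \<one>" "m dvd k"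
  shows "x [^] k = \<one>"
  using assms by (auto simp: int_pow_pow[symmetric] elim!: dvdE)

lemma int_pow_additive:
  assumes "\<And>i j :: int. f (i + j) = f i \<otimes> f j" "\<And>i. f i \<in> carrier G"
  shows "f 1 [^] (k::int) = f k"
proof -
  interpret f: group_hom integer_group G f
    using assms by (simp add: group_hom_def group_hom_axioms_def hom_def is_group)
  show ?thesis using f.hom_int_pow[of 1 k] by simp
qed

lemma ord_eqI:
  assumes "x \<in> carrier G" "x [^] int d = \<one>" "\<And>m. x [^] int m = \<one> \<Longrightarrow> d dvd m"
  shows "ord x = d"
proof (rule dvd_antisym)
  show "ord x dvd d" using assms(1,2) by (simp add: int_pow_eq_id)
  show "d dvd ord x" using assms(1) by (intro assms(3)) (simp add: int_pow_eq_id)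
qed

lemma ord_pos_if_int_pow_eq_one:
  assumes "x \<in> carrier G" "x [^] (k::int) = \<one>" "k \<noteq> 0"
  shows "ord x > 0"
  using assms by (auto simp: int_pow_eq_id intro: Nat.gr0I)

end

definition gcomm :: "('a, 'b) monoid_scheme \<Rightarrow> 'a \<Rightarrow> 'a \<Rightarrow> 'a" where
  "gcomm G x y = inv\<^bsub>G\<^esub> x \<otimes>\<^bsub>G\<^esub> inv\<^bsub>G\<^esub> y \<otimes>\<^bsub>G\<^esub> x \<otimes>\<^bsub>G\<^esub> y"

context group
begin

lemma gcomm_closed [simp]:
  "x \<in> carrier G \<Longrightarrow> y \<in> carrier G \<Longrightarrow> gcomm G x y \<in> carrier G"
  by (simp add: gcomm_def)

lemma inv_gcomm:
  "x \<in> carrier G \<Longrightarrow> y \<in> carrier G \<Longrightarrow> inv (gcomm G x y) = gcomm G y x"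
  by (simp add: gcomm_def inv_mult_group m_assoc)

lemma mult_gcomm:
  "x \<in> carrier G \<Longrightarrow> y \<in> carrier G \<Longrightarrow> y \<otimes> (x \<otimes> gcomm G x y) = x \<otimes> y"
  by (simp add: gcomm_def m_assoc)

lemma gcomm_eqI:
  assumes "x \<in> carrier G" "y \<in> carrier G" "z \<in> carrier G" "x \<otimes> y = y \<otimes> (x \<otimes> z)"
  shows "gcomm G x y = z"
  using assms mult_gcomm[of x y] by simp

lemma gcomm_eq_one_iff:
  assumes "x \<in> carrier G" "y \<in> carrier G"
  shows "gcomm G x y = \<one> \<longleftrightarrow> x \<otimes> y = y \<otimes> x"
  using assms mult_gcomm[of x y] gcomm_eqI[of x y \<one>] by auto

lemma commute_inv:
  assumes "x \<in> carrier G" "y \<in> carrier G" "x \<otimes> y = y \<otimes> x"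
  shows "x \<otimes> inv y = inv y \<otimes> x"
  using int_pow_commute[of y x "-1"] assms by (simp add: int_pow_neg)

lemma commute_mult:
  assumes "x \<in> carrier G" "y \<in> carrier G" "z \<in> carrier G"
    and "x \<otimes> y = y \<otimes> x" "x \<otimes> z = z \<otimes> x"
  shows "x \<otimes> (y \<otimes> z) = y \<otimes> z \<otimes> x"
  using assms by (metis m_assoc)

lemma commute_gcomm:
  assumes "x \<in> carrier G" "y \<in> carrier G" "z \<in> carrier G"
    and "x \<otimes> y = y \<otimes> x" "x \<otimes> z = z \<otimes> x"
  shows "x \<otimes> gcomm G y z = gcomm G y z \<otimes> x"
  using assms by (simp add: gcomm_def commute_mult commute_inv)

end

lemma (in group_hom) hom_gcomm:
  "x \<in> carrier G \<Longrightarrow> y \<in> carrier G \<Longrightarrow> h (gcomm G x y) = gcomm H (h x) (h y)"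
  by (simp add: gcomm_def)

locale macdonald = group G for G (structure) +
  fixes A B :: 'a and \<alpha> \<beta> :: int
  assumes A_closed [simp]: "A \<in> carrier G" and B_closed [simp]: "B \<in> carrier G"
    and rel_A: "inv gcomm G A B \<otimes> A \<otimes> gcomm G A B = A [^] \<alpha>"
    and rel_B: "gcomm G A B \<otimes> B \<otimes> inv gcomm G A B = B [^] \<beta>"
begin

abbreviation C where "C \<equiv> gcomm G A B"

lemma C_closed: "C \<in> carrier G"
  by simp

lemma gcomm_swap: "gcomm G B A = inv C"
  by (simp add: inv_gcomm)

lemma gcomm_swap_int_pow: "gcomm G B A [^] (k::int) = C [^] (- k)"
  by (simp add: gcomm_swap int_pow_inv int_pow_neg)

lemma macdonald_swap: "macdonald G B A \<beta> \<alpha>"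
proof
  show "inv gcomm G B A \<otimes> B \<otimes> gcomm G B A = B [^] \<beta>"
    "gcomm G B A \<otimes> A \<otimes> inv gcomm G B A = A [^] \<alpha>"
    using rel_A rel_B by (simp_all add: gcomm_swap)
qed simp_all

lemma A_pow_mult_C: "A [^] (x::int) \<otimes> C = C \<otimes> A [^] (x * \<alpha>)"
proof -
  have "A \<otimes> C = C \<otimes> A [^] \<alpha>" by (simp add: rel_A[symmetric] m_assoc)
  then have "A [^] x \<otimes> C = C \<otimes> (A [^] \<alpha>) [^] x" by (rule int_pow_conj[rotated 3]) simp_all
  then show ?thesis by (simp add: int_pow_pow mult.commute)
qed

lemma A_pow_mult_C_pow: "A [^] (x::int) \<otimes> C [^] int k = C [^] int k \<otimes> A [^] (x * \<alpha> ^ k)"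
proof (induction k arbitrary: x)
  case (Suc k)
  have "A [^] x \<otimes> C [^] int (Suc k) = C \<otimes> (A [^] (x * \<alpha>) \<otimes> C [^] int k)"
    unfolding int_pow_Suc(2)[OF C_closed] by (simp add: m_assoc[symmetric] A_pow_mult_C)
  also have "\<dots> = C [^] int (Suc k) \<otimes> A [^] (x * \<alpha> ^ Suc k)"
    unfolding int_pow_Suc(2)[OF C_closed] by (simp add: Suc m_assoc mult_ac)
  finally show ?case .
qed simp

lemma C_pow_mult_B_pow: "C [^] int k \<otimes> B [^] (x::int) = B [^] (x * \<beta> ^ k) \<otimes> C [^] int k"
proof -
  interpret swap: macdonald G B A \<beta> \<alpha> by (rule macdonald_swap)
  have "B [^] x \<otimes> inv (C [^] int k) = inv (C [^] int k) \<otimes> B [^] (x * \<beta> ^ k)"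
    using swap.A_pow_mult_C_pow[of x k] by (simp add: gcomm_swap_int_pow int_pow_neg)
  then have "C [^] int k \<otimes> (B [^] x \<otimes> inv (C [^] int k)) \<otimes> C [^] int k
      = C [^] int k \<otimes> (inv (C [^] int k) \<otimes> B [^] (x * \<beta> ^ k)) \<otimes> C [^] int k"
    by (simp only:)
  then show ?thesis by (simp add: m_assoc)
qed

lemma C_mult_B_pow: "C \<otimes> B [^] (x::int) = B [^] (x * \<beta>) \<otimes> C"
  using C_pow_mult_B_pow[of 1 x] by simp

lemma C_pow_mult_B: "C [^] int k \<otimes> B = B \<otimes> (B [^] (\<beta> ^ k - 1) \<otimes> C [^] int k)"
  using C_pow_mult_B_pow[of k 1] int_pow_mult_left[of B "C [^] int k" 1 "\<beta> ^ k - 1"] by simp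

lemma AC_pow: "(A \<otimes> C) [^] int k = C [^] int k \<otimes> A [^] (\<alpha> * geom_sum \<alpha> k)"
proof (induction k)
  case (Suc k)
  have "(A \<otimes> C) [^] int (Suc k) = C [^] int k \<otimes> (A [^] (\<alpha> * geom_sum \<alpha> k + 1) \<otimes> C)"
    unfolding int_pow_Suc(1)[OF m_closed[OF A_closed C_closed]]
    using int_pow_mult[of A "\<alpha> * geom_sum \<alpha> k" 1] by (simp add: Suc m_assoc)
  also have "\<dots> = C [^] int (Suc k) \<otimes> A [^] ((\<alpha> * geom_sum \<alpha> k + 1) * \<alpha>)"
    unfolding int_pow_Suc(1)[OF C_closed] by (simp add: A_pow_mult_C m_assoc)
  also have "(\<alpha> * geom_sum \<alpha> k + 1) * \<alpha> = \<alpha> * geom_sum \<alpha> (Suc k)"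
    by (simp add: geom_sum_Suc_shift algebra_simps)
  finally show ?case .
qed simp

lemma A_pow_mult_B: "A [^] int k \<otimes> B = B \<otimes> (C [^] int k \<otimes> A [^] (\<alpha> * geom_sum \<alpha> k))"
  using int_pow_conj[of A B "A \<otimes> C" "int k"] by (simp add: AC_pow mult_gcomm)

lemma B_pow_mult_A: "B [^] int k \<otimes> A = A \<otimes> (C [^] (- int k) \<otimes> B [^] (\<beta> * geom_sum \<beta> k))"
proof -
  interpret swap: macdonald G B A \<beta> \<alpha> by (rule macdonald_swap)
  show ?thesis using swap.A_pow_mult_B[of k] by (simp add: gcomm_swap_int_pow)
qed

lemma B_pow_neg_mult_A:
  "B [^] (- int k) \<otimes> A = A \<otimes> (B [^] (- (\<beta> * geom_sum \<beta> k)) \<otimes> C [^] int k)"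
proof -
  have "B [^] int k \<otimes> (A \<otimes> (B [^] (- (\<beta> * geom_sum \<beta> k)) \<otimes> C [^] int k))
      = B [^] int k \<otimes> A \<otimes> (B [^] (- (\<beta> * geom_sum \<beta> k)) \<otimes> C [^] int k)"
    by (simp add: m_assoc)
  also have "\<dots> = A"
    by (simp add: B_pow_mult_A m_assoc int_pow_mult_left flip: int_pow_mult)
  finally show ?thesis by (simp add: int_pow_neg inv_solve_left')
qed

end

lemma (in group) macdonaldI:
  assumes "A \<in> carrier G" "B \<in> carrier G"
    and "A \<otimes> gcomm G A B = gcomm G A B \<otimes> A [^] \<alpha>" "gcomm G A B \<otimes> B = B [^] \<beta> \<otimes> gcomm G A B"
  shows "macdonald G A B \<alpha> \<beta>"
  using assms by unfold_locales (simp_all add: m_assoc)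

lemma (in macdonald) macdonald_hom_image:
  assumes "group_hom G H h"
  shows "macdonald H (h A) (h B) \<alpha> \<beta>"
proof -
  interpret h: group_hom G H h by fact
  show ?thesis
  proof (rule h.H.macdonaldI)
    have "h (A \<otimes> C) = h (C \<otimes> A [^] \<alpha>)" using A_pow_mult_C[of 1] by simp
    then show "h A \<otimes>\<^bsub>H\<^esub> gcomm H (h A) (h B) = gcomm H (h A) (h B) \<otimes>\<^bsub>H\<^esub> h A [^]\<^bsub>H\<^esub> \<alpha>"
      by (simp add: h.hom_gcomm h.hom_int_pow)
    have "h (C \<otimes> B) = h (B [^] \<beta> \<otimes> C)" using C_mult_B_pow[of 1] by simp
    then show "gcomm H (h A) (h B) \<otimes>\<^bsub>H\<^esub> h B = h B [^]\<^bsub>H\<^esub> \<beta> \<otimes>\<^bsub>H\<^esub> gcomm H (h A) (h B)"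
      by (simp add: h.hom_gcomm h.hom_int_pow)
  qed simp_all
qed

section \<open>Finiteness of the orders\<close>

context macdonald
begin

text \<open>The relation \<open>A\<^bsup>C^r\<^esup> = A\<^bsup>\<alpha>^r\<^esup>\<close>, conjugated by \<open>B\<close>.\<close>
lemma conj_rel_A:
  assumes t: "\<alpha> ^ r = int t"
  shows "A \<otimes> (C \<otimes> (B [^] (\<beta> ^ r - 1) \<otimes> C [^] int r))
    = B [^] (\<beta> ^ r - 1) \<otimes> (C [^] int r \<otimes> (A \<otimes> C) [^] int t)"
proof -
  have AB: "A \<otimes> B = B \<otimes> (A \<otimes> C)" by (simp add: mult_gcomm)
  have "B \<otimes> (A \<otimes> (C \<otimes> (B [^] (\<beta> ^ r - 1) \<otimes> C [^] int r)))
      = A \<otimes> B \<otimes> (B [^] (\<beta> ^ r - 1) \<otimes> C [^] int r)"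
    unfolding AB by (simp add: m_assoc)
  also have "\<dots> = A \<otimes> C [^] int r \<otimes> B"
    by (simp add: m_assoc C_pow_mult_B)
  also have "A \<otimes> C [^] int r = C [^] int r \<otimes> A [^] int t"
    using A_pow_mult_C_pow[of 1 r] t by simp
  also have "\<dots> \<otimes> B = C [^] int r \<otimes> B \<otimes> (A \<otimes> C) [^] int t"
    using int_pow_conj[OF _ _ _ AB, of "int t"] by (simp add: m_assoc)
  also have "\<dots> = B \<otimes> (B [^] (\<beta> ^ r - 1) \<otimes> (C [^] int r \<otimes> (A \<otimes> C) [^] int t))"
    by (simp add: C_pow_mult_B m_assoc)
  finally show ?thesis by simp
qed

lemma B_pow_relation:
  assumes t: "\<alpha> ^ r = int t" and u: "\<beta> ^ r - 1 = int u"
  shows "B [^] (int u * \<beta> ^ (u + 1) - \<beta> * geom_sum \<beta> u)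
    = C [^] int (r + t) \<otimes> (A [^] (\<alpha> * geom_sum \<alpha> t - \<alpha> ^ (r + t)) \<otimes> C [^] (- int (u + 1 + r)))"
    (is "B [^] ?y = _")
proof -
  let ?g = "\<beta> * geom_sum \<beta> u" and ?C = "C [^] int (r + t)" and ?D = "C [^] int (u + 1 + r)"
  have C_add: "C [^] int (k + l) = C [^] int k \<otimes> C [^] int l" for k l
    by (simp add: int_pow_mult)
  have "A \<otimes> (B [^] ?y \<otimes> ?D)
      = A \<otimes> (B [^] (- ?g) \<otimes> (B [^] (int u * \<beta> ^ (u + 1)) \<otimes> C [^] int (u + 1) \<otimes> C [^] int r))"
    unfolding C_add[of "u + 1" r] by (simp add: m_assoc int_pow_mult_left)
  also have "\<dots> = A \<otimes> (B [^] (- ?g) \<otimes> C [^] int u) \<otimes> (C \<otimes> (B [^] int u \<otimes> C [^] int r))"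
    unfolding C_pow_mult_B_pow[symmetric] unfolding C_add[of u 1] by (simp add: m_assoc)
  also have "\<dots> = B [^] (- int u) \<otimes> (A \<otimes> (C \<otimes> (B [^] int u \<otimes> C [^] int r)))"
    unfolding B_pow_neg_mult_A[symmetric] by (simp add: m_assoc)
  also have "\<dots> = C [^] int r \<otimes> (A \<otimes> C) [^] int t"
    using conj_rel_A[OF t] by (simp add: u int_pow_mult_left)
  also have "\<dots> = ?C \<otimes> A [^] (\<alpha> * geom_sum \<alpha> t)"
    unfolding AC_pow C_add by (simp add: m_assoc)
  finally have "B [^] ?y \<otimes> ?D = A [^] (- 1 :: int) \<otimes> ?C \<otimes> A [^] (\<alpha> * geom_sum \<alpha> t)"
    by (simp add: int_pow_neg inv_solve_left m_assoc del: of_nat_add)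
  also have "\<dots> = ?C \<otimes> A [^] (\<alpha> * geom_sum \<alpha> t - \<alpha> ^ (r + t))"
    by (simp add: A_pow_mult_C_pow m_assoc del: of_nat_add flip: int_pow_mult)
  finally have "B [^] ?y = ?C \<otimes> A [^] (\<alpha> * geom_sum \<alpha> t - \<alpha> ^ (r + t)) \<otimes> inv ?D"
    by (simp add: inv_solve_right del: of_nat_add)
  then show ?thesis unfolding int_pow_neg[OF C_closed] by (simp add: m_assoc del: of_nat_add)
qed

lemma B_pow_eq_A_pow:
  assumes "B [^] (y::int) = C [^] int k \<otimes> (A [^] (x::int) \<otimes> C [^] (l::int))"
  shows "B [^] (y * (\<beta> - 1) * \<alpha> ^ Suc k) = A [^] (x - x * \<alpha>)"
proof -
  let ?C = "C [^] int (Suc k)"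
  have "B [^] (y * \<beta>) = C \<otimes> B [^] y \<otimes> inv C" by (simp add: C_mult_B_pow m_assoc)
  then have "B [^] (y * (\<beta> - 1)) = C \<otimes> B [^] y \<otimes> inv C \<otimes> inv (B [^] y)"
    by (simp add: right_diff_distrib int_pow_diff)
  also have "\<dots> = C \<otimes> C [^] int k \<otimes> (A [^] x \<otimes> (C [^] l \<otimes> inv C \<otimes> inv (C [^] l))
      \<otimes> (A [^] (- x) \<otimes> inv (C [^] int k)))"
    unfolding assms by (simp add: inv_mult_group m_assoc int_pow_neg)
  also have "C [^] l \<otimes> inv C = inv C \<otimes> C [^] l"
    by (intro commute_inv int_pow_commute_self) simp_all
  also have "C \<otimes> C [^] int k \<otimes> (A [^] x \<otimes> (inv C \<otimes> C [^] l \<otimes> inv (C [^] l))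
      \<otimes> (A [^] (- x) \<otimes> inv (C [^] int k)))
      = ?C \<otimes> (A [^] x \<otimes> inv C \<otimes> (A [^] (- x) \<otimes> C) \<otimes> inv ?C)"
  proof -
    have "inv (C [^] int k) = C \<otimes> inv ?C"
      unfolding int_pow_Suc(1)[OF C_closed] by (simp add: inv_mult_group)
    then show ?thesis
      unfolding int_pow_Suc(2)[OF C_closed, symmetric] by (simp add: m_assoc del: of_nat_Suc)
  qed
  also have "A [^] x \<otimes> inv C \<otimes> (A [^] (- x) \<otimes> C) = A [^] (x - x * \<alpha>)"
    by (simp add: A_pow_mult_C m_assoc flip: int_pow_mult)
  finally have "B [^] (y * (\<beta> - 1)) \<otimes> ?C = ?C \<otimes> A [^] (x - x * \<alpha>)"
    by (simp add: m_assoc del: of_nat_Suc)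
  then have "(B [^] (y * (\<beta> - 1))) [^] (\<alpha> ^ Suc k) \<otimes> ?C = ?C \<otimes> (A [^] (x - x * \<alpha>)) [^] (\<alpha> ^ Suc k)"
    by (intro int_pow_conj) simp_all
  also have "\<dots> = A [^] (x - x * \<alpha>) \<otimes> ?C"
    unfolding A_pow_mult_C_pow by (simp add: int_pow_pow del: of_nat_Suc)
  finally show ?thesis by (simp add: int_pow_pow del: of_nat_Suc power_Suc)
qed

lemma B_pow_eq_one_if_in_powers_A:
  assumes "B [^] (y::int) = A [^] (x::int)"
  shows "B [^] (y * (\<beta> - 1)) = \<one>"
proof -
  have "B [^] y \<otimes> C = C \<otimes> B [^] y"
  proof (rule commute_gcomm)
    show "B [^] y \<otimes> A = A \<otimes> B [^] y" by (simp add: assms int_pow_commute_self)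
    show "B [^] y \<otimes> B = B \<otimes> B [^] y" by (simp add: int_pow_commute_self)
  qed simp_all
  then have "B [^] y = B [^] (y * \<beta>)" by (simp add: C_mult_B_pow)
  then show ?thesis by (simp add: algebra_simps int_pow_diff)
qed

lemma C_pow_eq_B_pow:
  assumes "B [^] int m = \<one>"
  shows "C [^] int m = B [^] (\<beta> * geom_sum \<beta> m)"
proof -
  have "A = A \<otimes> (C [^] (- int m) \<otimes> B [^] (\<beta> * geom_sum \<beta> m))"
    using B_pow_mult_A[of m] by (simp add: assms)
  then show ?thesis by (simp add: int_pow_neg inv_solve_left')
qed

lemma C_pow_eq_one:
  assumes "B [^] int m = \<one>"
  shows "C [^] int (m * m) = \<one>"
proof -
  have "C [^] int (m * m) = (B [^] (\<beta> * geom_sum \<beta> m)) [^] int m"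
    by (simp add: int_pow_pow flip: C_pow_eq_B_pow[OF assms])
  also have "\<dots> = (B [^] int m) [^] (\<beta> * geom_sum \<beta> m)"
    by (simp add: int_pow_pow mult.commute)
  finally show ?thesis by (simp add: assms)
qed

lemma A_pow_eq_one:
  assumes "C [^] int m = \<one>"
  shows "A [^] (\<alpha> ^ m - 1) = \<one>"
  using A_pow_mult_C_pow[of 1 m] assms by (simp add: int_pow_diff)

end

lemma relation_exponent_nonzero:
  fixes t :: int
  assumes "\<bar>t\<bar> \<ge> 2" "k > 0"
  shows "int k * t ^ (k + 1) - t * geom_sum t k \<noteq> 0"
proof
  assume "int k * t ^ (k + 1) - t * geom_sum t k = 0"
  then have "t * (int k * t ^ k - geom_sum t k) = 0" by (simp add: algebra_simps)
  then have "int k * t ^ k = geom_sum t k" using assms(1) by auto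
  moreover obtain l where "k = Suc l" using assms(2) by (cases k) auto
  ultimately have "t * (int k * t ^ l - geom_sum t l) = 1"
    by (simp add: geom_sum_Suc_shift algebra_simps)
  then have "t dvd 1" by (metis dvd_triv_left)
  then show False using assms(1) by simp
qed

lemma power_minus_one_nonzero:
  fixes t :: int
  assumes "\<bar>t\<bar> \<ge> 2" "k > 0"
  shows "t ^ k - 1 \<noteq> 0"
proof
  assume "t ^ k - 1 = 0"
  then have "t dvd 1" using dvd_power[of k t] assms(2) by simp
  then show False using assms(1) by simp
qed

context macdonald
begin

theorem finite_orders:
  assumes "\<bar>\<alpha>\<bar> \<ge> 2" "\<bar>\<beta>\<bar> \<ge> 2"
  shows "ord A > 0" "ord B > 0" "ord C > 0"
proof -
  text \<open>Squares make the exponents positive, whatever the signs of \<open>\<alpha>\<close> and \<open>\<beta>\<close>.\<close>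
  define t u where "t = nat (\<alpha>\<^sup>2)" and "u = nat (\<beta>\<^sup>2 - 1)"
  have "\<beta>\<^sup>2 \<ge> 2\<^sup>2" using assms(2) by (simp only: abs_le_square_iff[symmetric])
  then have tu: "\<alpha>\<^sup>2 = int t" "\<beta>\<^sup>2 - 1 = int u" "u > 0" by (auto simp: t_def u_def)
  define y x where "y = int u * \<beta> ^ (u + 1) - \<beta> * geom_sum \<beta> u"
    and "x = \<alpha> * geom_sum \<alpha> t - \<alpha> ^ (2 + t)"
  have "B [^] (y * (\<beta> - 1) * \<alpha> ^ Suc (2 + t)) = A [^] (x - x * \<alpha>)"
    unfolding y_def x_def by (rule B_pow_eq_A_pow) (rule B_pow_relation[OF tu(1,2)])
  then have "B [^] (y * (\<beta> - 1) * \<alpha> ^ Suc (2 + t) * (\<beta> - 1)) = \<one>"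
    by (rule B_pow_eq_one_if_in_powers_A)
  moreover have "y \<noteq> 0" unfolding y_def using assms(2) tu(3) by (rule relation_exponent_nonzero)
  then have "y * (\<beta> - 1) * \<alpha> ^ Suc (2 + t) * (\<beta> - 1) \<noteq> 0" using assms by auto
  ultimately show B: "ord B > 0" by (rule ord_pos_if_int_pow_eq_one[OF B_closed])
  have "C [^] int (ord B * ord B) = \<one>" by (rule C_pow_eq_one) (simp add: int_pow_int)
  then show C: "ord C > 0" by (rule ord_pos_if_int_pow_eq_one[rotated]) (use B in simp_all)
  have "A [^] (\<alpha> ^ ord C - 1) = \<one>" by (rule A_pow_eq_one) (simp add: int_pow_int)
  then show "ord A > 0"
    by (rule ord_pos_if_int_pow_eq_one[rotated])
      (use power_minus_one_nonzero[OF assms(1) C] in simp_all)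
qed

end

section \<open>Prime divisors of the orders\<close>

lemma int_dvd_if_prime_powers_dvd:
  fixes n :: nat and x :: int
  assumes "n > 0" and prime_powers: "\<And>r k. prime r \<Longrightarrow> r ^ k dvd n \<Longrightarrow> int (r ^ k) dvd x"
  shows "int n dvd x"
proof (cases "x = 0")
  case False
  have "n dvd nat \<bar>x\<bar>"
  proof (rule multiplicity_le_imp_dvd)
    fix r :: nat assume r: "prime r"
    have "int (r ^ multiplicity r n) dvd x" by (intro prime_powers r multiplicity_dvd)
    then have "r ^ multiplicity r n dvd nat \<bar>x\<bar>" using int_dvd_int_iff[of _ "nat \<bar>x\<bar>"] by simp
    then show "multiplicity r n \<le> multiplicity r (nat \<bar>x\<bar>)"
      using r False by (intro multiplicity_geI) (auto dest: not_prime_unit)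
  qed (use assms in simp)
  then have "int n dvd int (nat \<bar>x\<bar>)" by (simp only: int_dvd_int_iff)
  then show ?thesis by simp
qed simp

lemma prime_power_dvd_geom_sum_if_totient_dvd:
  fixes t :: int
  assumes r: "prime r" and k: "k > 0" and t: "coprime t (int (r ^ k))" "\<not> int r dvd t - 1"
    and l: "totient (r ^ k) dvd l"
  shows "int (r ^ k) dvd geom_sum t l"
proof -
  have "residues (int (r ^ k))"
    unfolding residues_def using prime_gt_1_nat[OF r] k
    by (metis one_less_power of_nat_1 of_nat_less_iff)
  then have "[t ^ totient (r ^ k) = 1] (mod int (r ^ k))"
    using residues.euler_theorem[OF _ t(1)] by (simp only: nat_int)
  moreover obtain j where "l = totient (r ^ k) * j" using l by blast
  ultimately have "[t ^ l = 1] (mod int (r ^ k))"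
    unfolding \<open>l = _\<close> power_mult by (metis cong_pow power_one)
  then have "int (r ^ k) dvd (t - 1) * geom_sum t l"
    by (simp add: minus_one_times_geom_sum cong_iff_dvd_diff)
  moreover have "coprime (int (r ^ k)) (t - 1)"
    using prime_imp_coprime[of "int r" "t - 1"] r t(2) by simp
  ultimately show ?thesis by (simp only: coprime_dvd_mult_right_iff)
qed

lemma prime_power_dvd_div_prime:
  fixes d q r :: nat
  assumes "prime r" "prime q" "r \<noteq> q" "q dvd d" "r ^ k dvd d"
  shows "r ^ k dvd d div q"
proof -
  have "coprime (r ^ k) q" using assms(1-3) by (simp add: primes_coprime coprime_power_left_iff)
  moreover have "r ^ k dvd q * (d div q)" using assms(4,5) by simp
  ultimately show ?thesis by (simp only: coprime_dvd_mult_right_iff)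
qed

lemma totient_prime_power_Suc_dvd_mult_fact:
  assumes "prime r" "r ^ k dvd m" "r \<le> q"
  shows "totient (r ^ Suc k) dvd m * fact (q - 1)"
proof -
  have "r - 1 dvd fact (q - 1)" using prime_gt_1_nat[OF assms(1)] assms(3) by (intro dvd_fact) auto
  then show ?thesis
    using assms(2) by (simp only: totient_prime_power_Suc[OF assms(1)] mult_dvd_mono)
qed

lemma dvd_geom_sum_fact:
  fixes t :: int
  assumes d: "d > 0" and q: "prime q" "q dvd d" and coprime: "coprime t (int d)"
    and large: "\<And>r. prime r \<Longrightarrow> r dvd d \<Longrightarrow> r > q \<Longrightarrow> int r dvd t - 1"
    and q_not_dvd: "\<not> int q dvd t - 1"
  shows "int d dvd geom_sum t (d div q * fact (q - 1))"
proof (rule int_dvd_if_prime_powers_dvd[OF d])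
  fix r k assume r: "prime r" and rk: "r ^ k dvd d"
  consider "k = 0" | "k > 0" "int r dvd t - 1" | "k > 0" "\<not> int r dvd t - 1" by blast
  then show "int (r ^ k) dvd geom_sum t (d div q * fact (q - 1))"
  proof cases
    case 2
    then have "r \<noteq> q" using q_not_dvd by blast
    then have "r ^ k dvd d div q * fact (q - 1)"
      using r q rk by (intro dvd_mult2 prime_power_dvd_div_prime)
    then show ?thesis
    proof (rule dvd_geom_sum)
      show "int p dvd t - 1" if "prime p" "p dvd r ^ k" for p
        using that r 2(2) by (metis prime_dvd_power primes_dvd_imp_eq)
    qed (use prime_gt_0_nat[OF r] in simp)
  next
    case 3
    then obtain j where j: "k = Suc j" by (cases k) auto
    have "r ^ j dvd d div q"
    proof (cases "r = q")
      case True
      then have "q * r ^ j dvd q * (d div q)" using rk q(2) by (simp add: j)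
      then show ?thesis using prime_gt_0_nat[OF q(1)] by simp
    next
      case False
      then show ?thesis
        using prime_power_dvd_div_prime[OF r q(1) _ q(2) rk] j by (metis dvd_mult_right power_Suc)
    qed
    moreover have "r dvd d" using rk j by (metis dvd_mult_left power_Suc)
    then have "r \<le> q" using large[OF r] 3(2) by force
    ultimately have "totient (r ^ k) dvd d div q * fact (q - 1)"
      unfolding j using r by (intro totient_prime_power_Suc_dvd_mult_fact)
    moreover have "coprime t (int (r ^ k))"
      using coprime rk by (meson coprime_divisors dvd_refl int_dvd_int_iff)
    ultimately show ?thesis using r 3 by (intro prime_power_dvd_geom_sum_if_totient_dvd)
  qed simp
qed

context macdonald
begin

lemma coprime_ord_A:
  assumes "ord C > 0"
  shows "coprime \<alpha> (int (ord A))"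
proof -
  have "A [^] (\<alpha> ^ ord C - 1) = \<one>" by (rule A_pow_eq_one) (simp add: int_pow_int)
  then have "int (ord A) dvd \<alpha> ^ ord C - 1" by (simp add: int_pow_eq_id)
  moreover have "coprime (\<alpha> ^ ord C - 1) (\<alpha> ^ ord C)" by (rule coprime_diff_one_left)
  then have "coprime (\<alpha> ^ ord C - 1) \<alpha>" using assms by simp
  then have "coprime \<alpha> (\<alpha> ^ ord C - 1)" by (subst coprime_commute)
  ultimately show ?thesis by (meson coprime_divisors dvd_refl)
qed

text \<open>Here \<open>A\<^bsup>k(\<alpha>-1)\<^esup>\<close> turns out to be a power of \<open>B\<close>, hence central.\<close>
lemma A_pow_eq_one_if_conj_C_pow:
  assumes conj: "A [^] int k \<otimes> B = B \<otimes> C [^] int k"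
  shows "A [^] (int k * (\<alpha> - 1) * (\<alpha> - 1)) = \<one>"
proof -
  define u where "u = \<beta> - 1"
  let ?X = "A [^] int k" and ?Y = "C [^] int k"
  have CB: "C \<otimes> B = B \<otimes> (B [^] u \<otimes> C)" using C_pow_mult_B[of 1] by (simp add: u_def)
  have XB: "?X [^] l \<otimes> B = B \<otimes> ?Y [^] l" for l :: int
    by (rule int_pow_conj) (simp_all add: conj)
  have "B \<otimes> (?Y \<otimes> (B [^] u \<otimes> C)) = ?X \<otimes> (C \<otimes> B)"
    unfolding CB using conj by (simp add: m_assoc[symmetric])
  also have "\<dots> = C \<otimes> (?X [^] \<alpha> \<otimes> B)"
    by (simp add: m_assoc[symmetric] A_pow_mult_C int_pow_pow)
  also have "\<dots> = B \<otimes> (B [^] u \<otimes> (C \<otimes> ?Y [^] \<alpha>))"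
    unfolding XB by (simp add: m_assoc[symmetric] CB)
  also have "C \<otimes> ?Y [^] \<alpha> = ?Y [^] \<alpha> \<otimes> C"
    by (simp add: int_pow_pow int_pow_commute_self)
  finally have "?Y \<otimes> (B [^] u \<otimes> C) = B [^] u \<otimes> (?Y [^] \<alpha> \<otimes> C)" by simp
  then have "?Y \<otimes> B [^] u = B [^] u \<otimes> ?Y [^] \<alpha>" by (simp add: m_assoc[symmetric])
  then have "B [^] (u * \<beta> ^ k) \<otimes> ?Y = B [^] u \<otimes> ?Y [^] \<alpha>" by (simp add: C_pow_mult_B_pow)
  then have "B [^] (- u) \<otimes> (B [^] (u * \<beta> ^ k) \<otimes> ?Y) \<otimes> inv ?Y
      = B [^] (- u) \<otimes> (B [^] u \<otimes> ?Y [^] \<alpha>) \<otimes> inv ?Y" by simp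
  then have "?Y [^] (\<alpha> - 1) = B [^] (u * \<beta> ^ k - u)"
    using int_pow_diff[of ?Y \<alpha> 1] by (simp add: int_pow_mult_left m_assoc)
  then have "?X [^] (\<alpha> - 1) \<otimes> B = B [^] (u * \<beta> ^ k - u) \<otimes> B"
    unfolding XB by (simp add: int_pow_commute_self)
  then have "A [^] (int k * (\<alpha> - 1)) = B [^] (u * \<beta> ^ k - u)" by (simp add: int_pow_pow)
  then show ?thesis
    using macdonald.B_pow_eq_one_if_in_powers_A[OF macdonald_swap] by blast
qed

lemma prime_dvd_if_ord_A_dvd_geom_sum:
  assumes q: "prime q" "q dvd ord A" and ord_A: "ord A > 0"
    and dvd: "int (ord A) dvd geom_sum \<alpha> (ord A div q * fact (q - 1))"
  shows "int q dvd \<alpha> - 1"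
proof (rule ccontr)
  assume not_dvd: "\<not> int q dvd \<alpha> - 1"
  define k where "k = ord A div q * fact (q - 1)"
  have "A [^] (\<alpha> * geom_sum \<alpha> k) = \<one>" using dvd by (simp add: k_def int_pow_eq_id)
  then have "A [^] int k \<otimes> B = B \<otimes> C [^] int k" by (simp add: A_pow_mult_B)
  then have "A [^] (int k * (\<alpha> - 1) * (\<alpha> - 1)) = \<one>" by (rule A_pow_eq_one_if_conj_C_pow)
  then have "int (ord A) dvd int k * (\<alpha> - 1) * (\<alpha> - 1)" by (simp add: int_pow_eq_id)
  moreover have ord_A_eq: "int (ord A) = int (ord A div q) * int q"
    using q(2) by (simp flip: of_nat_mult)
  ultimately have "int (ord A div q) * int q
      dvd int (ord A div q) * (int (fact (q - 1)) * (\<alpha> - 1) * (\<alpha> - 1))"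
    unfolding ord_A_eq[symmetric] by (simp add: k_def mult.assoc)
  moreover have "ord A div q \<noteq> 0" using ord_A q(2) by (auto simp: dvd_div_eq_0_iff)
  ultimately have "int q dvd int (fact (q - 1)) * (\<alpha> - 1) * (\<alpha> - 1)" by simp
  then have "int q dvd int (fact (q - 1))"
    using q(1) not_dvd by (simp only: prime_dvd_mult_iff prime_nat_int_transfer) blast
  then have "q dvd fact (q - 1)" by (simp only: int_dvd_int_iff)
  then show False using prime_gt_1_nat[OF q(1)] by (simp add: prime_dvd_fact_iff q(1))
qed

theorem prime_dvd_ord_A:
  assumes fin: "ord A > 0" "ord C > 0" and p: "prime p" "p dvd ord A"
  shows "int p dvd \<alpha> - 1"
proof (rule ccontr)
  assume not_dvd: "\<not> int p dvd \<alpha> - 1"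
  define S where "S = {q. prime q \<and> q dvd ord A \<and> \<not> int q dvd \<alpha> - 1}"
  define q where "q = Max S"
  have "finite S" unfolding S_def by (rule finite_subset[OF _ finite_divisors_nat[OF fin(1)]]) auto
  moreover have "p \<in> S" using p not_dvd by (simp add: S_def)
  ultimately have "q \<in> S" and max: "r \<le> q" if "r \<in> S" for r
    unfolding q_def using that by (auto intro: Max_in Max_ge)
  then have q: "prime q" "q dvd ord A" "\<not> int q dvd \<alpha> - 1" using \<open>p \<in> S\<close> by (auto simp: S_def)
  have "int (ord A) dvd geom_sum \<alpha> (ord A div q * fact (q - 1))"
    using fin(1) q(1,2) coprime_ord_A[OF fin(2)] _ q(3)
  proof (rule dvd_geom_sum_fact)
    show "int r dvd \<alpha> - 1" if "prime r" "r dvd ord A" "r > q" for r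
      using that max[of r] by (auto simp: S_def)
  qed
  then show False using prime_dvd_if_ord_A_dvd_geom_sum[OF q(1,2) fin(1)] q(3) by blast
qed

end

section \<open>Groups generated by elements of finite order\<close>

context group
begin

lemma torsion_generate_induct [consumes 1, case_names generators torsion one mult]:
  assumes x: "x \<in> generate G S" and S: "S \<subseteq> carrier G" and torsion: "\<And>s. s \<in> S \<Longrightarrow> ord s > 0"
    and one: "P \<one>" and mult: "\<And>x s. x \<in> carrier G \<Longrightarrow> P x \<Longrightarrow> s \<in> S \<Longrightarrow> P (x \<otimes> s)"
  shows "P x"
proof -
  have "\<forall>y\<in>carrier G. P y \<longrightarrow> P (y \<otimes> x)"
    using x
  proof induction
    case (inv s)
    then have s: "s \<in> carrier G" "ord s > 0" using S torsion by auto
    have "s [^] (ord s - 1) \<otimes> s = \<one>" using s by (metis Suc_pred' nat_pow_Suc pow_ord_eq_1)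
    then have "inv s = s [^] (ord s - 1)" using s by (simp add: inv_equality)
    moreover have "P (y \<otimes> s [^] (k::nat))" if "y \<in> carrier G" "P y" for y k
    proof (induction k)
      case (Suc k)
      then show ?case using mult[OF _ Suc inv] that s by (simp add: m_assoc)
    qed (use that in simp)
    ultimately show ?case by simp
  next
    case (eng x y)
    then have "x \<in> carrier G" "y \<in> carrier G" using S generate_in_carrier by auto
    then show ?case using eng.IH by (simp add: m_assoc[symmetric])
  qed (use S in \<open>auto intro: mult\<close>)
  moreover have "x \<in> carrier G" using S x generate_in_carrier by blast
  ultimately show ?thesis using one by fastforce
qed

lemma normal_if_torsion_generators_normalize:
  assumes H: "subgroup H G" and gen: "carrier G = generate G S"
    and torsion: "\<And>s. s \<in> S \<Longrightarrow> ord s > 0"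
    and conj: "\<And>s h. s \<in> S \<Longrightarrow> h \<in> H \<Longrightarrow> inv s \<otimes> h \<otimes> s \<in> H"
  shows "H \<lhd> G"
proof (rule normal_invI[OF H])
  have S: "S \<subseteq> carrier G" unfolding gen by (auto intro: generate.incl)
  have "\<forall>h\<in>H. inv x \<otimes> h \<otimes> x \<in> H" if "x \<in> carrier G" for x
    using that[unfolded gen]
  proof (induction rule: torsion_generate_induct)
    case (mult x s)
    show ?case
    proof
      fix h assume h: "h \<in> H"
      then have "inv (x \<otimes> s) \<otimes> h \<otimes> (x \<otimes> s) = inv s \<otimes> (inv x \<otimes> h \<otimes> x) \<otimes> s"
        using mult S subgroup.mem_carrier[OF H h] by (auto simp: inv_mult_group m_assoc)
      then show "inv (x \<otimes> s) \<otimes> h \<otimes> (x \<otimes> s) \<in> H" using mult conj h by simp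
    qed
  qed (use S torsion subgroup.mem_carrier[OF H] in auto)
  then show "x \<otimes> h \<otimes> inv x \<in> H" if "x \<in> carrier G" "h \<in> H" for x h
    using that inv_closed[of x] inv_inv[of x] by metis
qed

lemma set_mult_generate_cases:
  assumes "x \<in> carrier G" "g \<in> H <#> generate G {x}"
  obtains h and i :: int where "g = h \<otimes> x [^] i" "h \<in> H"
  using assms by (auto simp: set_mult_def generate_pow)

lemma nat_pow_mem_if_mem_set_mult_generate:
  assumes N: "H \<lhd> G" and x: "x \<in> carrier G" "x [^] (p::nat) \<in> H" and g: "g \<in> H <#> generate G {x}"
  shows "g [^] p \<in> H"
proof -
  interpret H: normal H G by fact
  obtain h and i :: int where g: "g = h \<otimes> x [^] i" "h \<in> H"
    using x(1) g by (rule set_mult_generate_cases)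
  then have "H #> g = H #> x [^] i"
    using x coset_mult_assoc[OF H.subset, of h "x [^] i"] H.rcos_const[OF is_group] by simp
  then have "H #> g [^] p = H #> (x [^] i) [^] p"
    using H.FactGroup_pow[of g p] H.FactGroup_pow[of "x [^] i" p] g x by simp
  also have "(x [^] i) [^] p = (x [^] p) [^] i"
    using x by (simp only: int_pow_int[symmetric] int_pow_pow mult.commute)
  also have "H #> (x [^] p) [^] i = H"
    by (rule H.rcos_const[OF is_group subgroup_int_pow_closed[OF H.subgroup_axioms x(2)]])
  finally show ?thesis by (rule coset_join1[OF _ _ H.subgroup_axioms]) (use g x in simp_all)
qed

lemma normal_cyclic_extension:
  assumes gen: "carrier G = generate G S" and torsion: "\<And>s. s \<in> S \<Longrightarrow> ord s > 0"
    and N: "H \<lhd> G" and x: "x \<in> carrier G" "x [^] (p::nat) \<in> H"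
    and conj: "\<And>s K. s \<in> S \<Longrightarrow> subgroup K G \<Longrightarrow> H \<subseteq> K \<Longrightarrow> x \<in> K \<Longrightarrow> inv s \<otimes> x \<otimes> s \<in> K"
  obtains K where "K \<lhd> G" "H \<subseteq> K" "x \<in> K" "\<And>g. g \<in> K \<Longrightarrow> g [^] p \<in> H"
proof -
  interpret H: normal H G by fact
  interpret second_isomorphism_grp H G "generate G {x}"
    using N x by (simp add: second_isomorphism_grp_def second_isomorphism_grp_axioms_def
        generate_is_subgroup)
  define K where "K = H <#> generate G {x}"
  have K: "subgroup K G" unfolding K_def by (rule normal_set_mult_subgroup)
  have HK: "H \<subseteq> K" and xK: "x \<in> K"
    using H_contained_in_set_mult S_contained_in_set_mult generate.incl[of x "{x}" G]
    by (auto simp: K_def)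
  have S: "S \<subseteq> carrier G" unfolding gen by (auto intro: generate.incl)
  have "K \<lhd> G"
    using K gen torsion
  proof (rule normal_if_torsion_generators_normalize)
    fix s g assume s: "s \<in> S" and "g \<in> K"
    then obtain h and i :: int where g: "g = h \<otimes> x [^] i" "h \<in> H"
      unfolding K_def using set_mult_generate_cases[OF x(1)] by metis
    have [simp]: "s \<in> carrier G" "h \<in> carrier G" using s S g by auto
    have "x [^] i \<otimes> s = s \<otimes> (inv s \<otimes> x \<otimes> s) [^] i"
      using x by (intro int_pow_conj) (simp_all add: m_assoc)
    then have "inv s \<otimes> g \<otimes> s = (inv s \<otimes> h \<otimes> s) \<otimes> (inv s \<otimes> x \<otimes> s) [^] i"
      using x by (simp add: g m_assoc)
    moreover have "inv s \<otimes> h \<otimes> s \<in> K" using H.inv_op_closed1[of s h] g HK by auto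
    moreover have "(inv s \<otimes> x \<otimes> s) [^] i \<in> K"
      using K conj[OF s K HK xK] by (rule subgroup_int_pow_closed)
    ultimately show "inv s \<otimes> g \<otimes> s \<in> K" using subgroup.m_closed[OF K] by simp
  qed
  then show ?thesis
    using HK xK nat_pow_mem_if_mem_set_mult_generate[OF N x] by (intro that) (simp_all add: K_def)
qed

lemma int_pow_mem_if_gcd_dvd:
  assumes H: "subgroup H G" and x: "x \<in> carrier G" "x [^] (k::int) \<in> H"
    and "gcd k (int (ord x)) dvd i"
  shows "x [^] i \<in> H"
proof -
  obtain r s where "r * k + s * int (ord x) = gcd k (int (ord x))" using bezout_int by blast
  moreover obtain l where "i = gcd k (int (ord x)) * l" using assms(4) by blast
  ultimately have "i = (r * k + s * int (ord x)) * l" by simp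
  then have "[i = k * (r * l)] (mod int (ord x))"
    by (simp add: cong_iff_dvd_diff algebra_simps)
  then have "x [^] i = x [^] (k * (r * l))"
    using x by (intro int_pow_cong) (simp_all add: int_pow_eq_id)
  then show ?thesis
    using subgroup_int_pow_closed[OF H x(2), of "r * l"] x by (simp add: int_pow_pow)
qed

end

lemma gcd_dvd_geom_sum:
  fixes t :: int
  assumes "d > 0" "\<And>q. prime q \<Longrightarrow> q dvd d \<Longrightarrow> int q dvd t - 1"
  shows "gcd (int k) (int d) dvd geom_sum t k"
proof -
  have "int (gcd k d) dvd geom_sum t k"
    by (rule dvd_geom_sum) (use assms in auto)
  then show ?thesis by (simp add: gcd_int_int_eq)
qed

lemma gcd_dvd_power_minus_one:
  fixes t :: int
  assumes d: "d > 0" "\<And>q. prime q \<Longrightarrow> q dvd d \<Longrightarrow> int q dvd t - 1" and p: "prime p"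
  shows "gcd (int (k * p)) (int d) dvd t ^ k - 1"
proof (cases "p dvd d")
  case True
  have "gcd (int (k * p)) (int d) dvd gcd (int p * int k) (int p * int d)"
    by (rule gcd_greatest) (simp_all add: mult.commute[of "int p"])
  also have "\<dots> = int p * gcd (int k) (int d)" by (simp add: gcd_mult_distrib_int[symmetric])
  also have "\<dots> dvd (t - 1) * geom_sum t k"
    using d(2)[OF p True] gcd_dvd_geom_sum[OF d] by (rule mult_dvd_mono)
  finally show ?thesis by (simp add: minus_one_times_geom_sum)
next
  case False
  then have "coprime p d" using p by (rule prime_imp_coprime[rotated])
  then have "gcd (int (k * p)) (int d) = gcd (int k) (int d)"
    by (simp add: gcd_mult_right_right_cancel coprime_commute gcd_mult_left_right_cancel)
  then show ?thesis using gcd_dvd_geom_sum[OF d, of k] by (simp flip: minus_one_times_geom_sum)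
qed

section \<open>Primary decompositions\<close>

locale primary_decomposition = group G for G (structure) +
  fixes p :: nat and P P' :: "'a set"
  assumes prime: "prime p"
    and subgroups: "subgroup P G" "subgroup P' G"
    and commute: "x \<in> P \<Longrightarrow> y \<in> P' \<Longrightarrow> x \<otimes> y = y \<otimes> x"
    and cover: "carrier G = P <#> P'"
    and ord_P: "x \<in> P \<Longrightarrow> \<exists>k. ord x = p ^ k"
    and ord_P': "y \<in> P' \<Longrightarrow> coprime (ord y) p"
begin

sublocale P: subgroup P G by (rule subgroups)
sublocale P': subgroup P' G by (rule subgroups)

lemma decompose:
  assumes "g \<in> carrier G"
  obtains x y where "x \<in> P" "y \<in> P'" "g = x \<otimes> y"
  using assms cover by (auto simp: set_mult_def)

lemma eq_one_if_ord_coprime: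
  assumes "x \<in> P" "coprime (ord x) p"
  shows "x = \<one>"
proof -
  obtain k where "ord x = p ^ k" using ord_P assms(1) by blast
  then have "ord x = 1"
    using assms(2) prime by (auto simp: coprime_power_left_iff dest: not_prime_unit)
  then show ?thesis using ord_eq_1 assms(1) P.mem_carrier by blast
qed

lemma eq_one_if_ord_prime_power:
  assumes "y \<in> P'" "ord y dvd p ^ k"
  shows "y = \<one>"
proof -
  have "coprime (ord y) (p ^ k)" using ord_P'[OF assms(1)] by simp
  then have "ord y = 1" using coprime_absorb_left[OF assms(2)] by simp
  then show ?thesis using ord_eq_1 assms(1) P'.mem_carrier by blast
qed

lemma decomposition_unique:
  assumes "x \<in> P" "y \<in> P'" "x' \<in> P" "y' \<in> P'" "x \<otimes> y = x' \<otimes> y'"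
  shows "x = x'" "y = y'"
proof -
  interpret group_disjoint_sum G P P' by unfold_locales
  have "P \<inter> P' \<subseteq> {\<one>}" using eq_one_if_ord_coprime ord_P' by blast
  then show "x = x'" "y = y'" using assms cancel by blast+
qed

lemma pelems_eq: "pelems p G = P"
proof (intro equalityI subsetI)
  fix g assume "g \<in> pelems p G"
  then obtain k where g: "g \<in> carrier G" "ord g = p ^ k" by (auto simp: pelems_def)
  obtain x y where xy: "x \<in> P" "y \<in> P'" "g = x \<otimes> y" using g decompose by blast
  obtain l where "ord x = p ^ l" using ord_P xy by blast
  have y: "y = inv x \<otimes> g" using xy by simp
  moreover have "y = g \<otimes> inv x" using xy commute[OF xy(1,2)] by (simp add: m_assoc)
  ultimately have "ord (inv x \<otimes> g) dvd ord (inv x) * ord g"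
    using xy(1) g(1) by (intro ord_mul_divides) simp_all
  then have "ord y dvd p ^ (l + k)" using xy g \<open>ord x = p ^ l\<close> by (simp add: power_add flip: y)
  then have "y = \<one>" using eq_one_if_ord_prime_power xy by blast
  then show "g \<in> P" using xy by simp
qed (use ord_P in \<open>auto simp: pelems_def\<close>)

lemma mem_P'_if_ord_coprime:
  assumes g: "g \<in> carrier G" "coprime (ord g) p"
  shows "g \<in> P'"
proof -
  obtain x y where xy: "x \<in> P" "y \<in> P'" "g = x \<otimes> y" using g decompose by blast
  have x: "x = g \<otimes> inv y" using xy by (simp add: m_assoc)
  have "g \<otimes> inv y = inv y \<otimes> g"
    using xy commute[of x y] g by (intro commute_inv) (simp_all add: m_assoc)
  then have "ord (g \<otimes> inv y) dvd ord g * ord (inv y)"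
    using xy(2) g(1) by (intro ord_mul_divides) simp_all
  then have "ord x dvd ord g * ord y" unfolding x[symmetric] using xy(2) by simp
  moreover have "coprime (ord g * ord y) p" using g ord_P' xy by simp
  ultimately have "coprime (ord x) p" by (meson coprime_divisors dvd_refl)
  then have "x = \<one>" using xy(1) by (intro eq_one_if_ord_coprime)
  then show ?thesis using xy by simp
qed

lemma ppart_mult:
  assumes "x \<in> P" "y \<in> P'"
  shows "ppart p G (x \<otimes> y) = x"
  unfolding ppart_def
proof (rule the_equality)
  show "x \<in> carrier G \<and> (\<exists>k. ord x = p ^ k) \<and>
      (\<exists>y'\<in>carrier G. coprime (ord y') p \<and> x \<otimes> y' = x \<otimes> y \<and> x \<otimes> y' = y' \<otimes> x)"
    using assms ord_P ord_P' commute by (intro conjI bexI[of _ y]) simp_all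
next
  fix x' assume x': "x' \<in> carrier G \<and> (\<exists>k. ord x' = p ^ k) \<and>
      (\<exists>y'\<in>carrier G. coprime (ord y') p \<and> x' \<otimes> y' = x \<otimes> y \<and> x' \<otimes> y' = y' \<otimes> x')"
  then have "x' \<in> P" unfolding pelems_eq[symmetric] pelems_def by blast
  moreover obtain y' where "y' \<in> P'" "x' \<otimes> y' = x \<otimes> y" using x' mem_P'_if_ord_coprime by blast
  ultimately show "x' = x" using decomposition_unique assms by metis
qed

lemma ppart_mem:
  assumes "g \<in> carrier G"
  shows "ppart p G g \<in> P"
  using assms by (rule decompose) (simp add: ppart_mult)

abbreviation "Syl \<equiv> G\<lparr>carrier := pelems p G\<rparr>"

sublocale ppart: group_hom G Syl "ppart p G"
proof -
  have "ppart p G (g \<otimes> h) = ppart p G g \<otimes> ppart p G h"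
    if g: "g \<in> carrier G" and h: "h \<in> carrier G" for g h
  proof -
    obtain x y where xy: "x \<in> P" "y \<in> P'" "g = x \<otimes> y" using g by (rule decompose)
    obtain x' y' where xy': "x' \<in> P" "y' \<in> P'" "h = x' \<otimes> y'" using h by (rule decompose)
    have "g \<otimes> h = x \<otimes> (y \<otimes> x') \<otimes> y'" using xy xy' by (simp add: m_assoc)
    also have "y \<otimes> x' = x' \<otimes> y" using commute[OF xy'(1) xy(2)] by simp
    finally have "g \<otimes> h = (x \<otimes> x') \<otimes> (y \<otimes> y')" using xy xy' by (simp add: m_assoc)
    then show ?thesis using xy xy' by (simp add: ppart_mult)
  qed
  then have "ppart p G \<in> hom G Syl" by (auto simp: hom_def pelems_eq ppart_mem)
  moreover have "group Syl" unfolding pelems_eq by (rule P.subgroup_is_group[OF is_group])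
  ultimately show "group_hom G Syl (ppart p G)"
    by (simp add: group_hom_def group_hom_axioms_def is_group)
qed

lemma ppart_image: "ppart p G ` carrier G = carrier Syl"
proof
  show "carrier Syl \<subseteq> ppart p G ` carrier G"
  proof
    fix x assume "x \<in> carrier Syl"
    then have x: "x \<in> P" by (simp add: pelems_eq)
    then have "x = ppart p G x" using ppart_mult[OF x P'.one_closed] by simp
    then show "x \<in> ppart p G ` carrier G" using x by (rule image_eqI[OF _ P.mem_carrier])
  qed
qed (use ppart_mem in \<open>auto simp: pelems_eq\<close>)

lemma decompose_ppart:
  assumes "g \<in> carrier G"
  obtains y where "y \<in> P'" "g = ppart p G g \<otimes> y"
proof -
  obtain x y where "x \<in> P" "y \<in> P'" "g = x \<otimes> y" using assms by (rule decompose)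
  then show ?thesis using that[of y] ppart_mult[of x y] by simp
qed

end

section \<open>Nilpotency\<close>

context macdonald
begin

lemma C_pow_conj_A: "inv A \<otimes> C [^] int k \<otimes> A = C [^] int k \<otimes> A [^] (1 - \<alpha> ^ k)"
proof -
  have "inv A \<otimes> C [^] int k = C [^] int k \<otimes> A [^] (- (\<alpha> ^ k))"
    using A_pow_mult_C_pow[of "-1" k] by (simp add: int_pow_neg)
  moreover have "A [^] (- (\<alpha> ^ k)) \<otimes> A = A [^] (1 - \<alpha> ^ k)"
    using int_pow_mult[of A "- (\<alpha> ^ k)" 1] by simp
  ultimately show ?thesis by (simp add: m_assoc)
qed

lemma C_pow_conj_B: "inv B \<otimes> C [^] int k \<otimes> B = B [^] (\<beta> ^ k - 1) \<otimes> C [^] int k"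
  by (simp add: C_pow_mult_B m_assoc)

lemma A_pow_conj_B: "inv B \<otimes> A [^] int k \<otimes> B = C [^] int k \<otimes> A [^] (\<alpha> * geom_sum \<alpha> k)"
  by (simp add: A_pow_mult_B m_assoc)

lemma B_pow_conj_A: "inv A \<otimes> B [^] int k \<otimes> A = C [^] (- int k) \<otimes> B [^] (\<beta> * geom_sum \<beta> k)"
  by (simp add: B_pow_mult_A m_assoc)

end

lemma prime_power_if_prime_factors_subset:
  fixes n :: nat
  assumes "n > 0" "prime p" "prime_factors n \<subseteq> {p}"
  shows "\<exists>k. n = p ^ k"
proof -
  have "n = p ^ multiplicity p n"
    using prime_factorization_nat[of n] assms
    by (cases "p \<in> prime_factors n") (auto simp: subset_singleton_iff prime_factors_multiplicity)
  then show ?thesis ..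
qed

context group
begin

lemma prime_factors_ord_subset:
  assumes "g \<in> carrier G" "prime p" "ord (g [^] (p ^ k)) > 0"
  shows "ord g > 0" "prime_factors (ord g) \<subseteq> insert p (prime_factors (ord (g [^] (p ^ k))))"
proof -
  let ?o = "p ^ k * ord (g [^] (p ^ k))"
  have "?o > 0" using assms prime_gt_0_nat by simp
  have "g [^] ?o = \<one>" using assms(1) by (simp flip: nat_pow_pow)
  then have dvd: "ord g dvd ?o" using assms(1) by (simp add: pow_eq_id)
  then show "ord g > 0" using \<open>?o > 0\<close> by (auto intro: Nat.gr0I)
  have "prime_factors (ord g) \<subseteq> prime_factors ?o"
    using \<open>?o > 0\<close> dvd by (intro dvd_prime_factors) simp_all
  also have "\<dots> \<subseteq> insert p (prime_factors (ord (g [^] (p ^ k))))"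
    using assms \<open>?o > 0\<close> by (auto simp: prime_factors_product prime_factorization_prime_power)
  finally show "prime_factors (ord g) \<subseteq> insert p (prime_factors (ord (g [^] (p ^ k))))" .
qed

lemma mem_set_mult_if_coprime_powers:
  assumes "subgroup P G" "subgroup P' G" and x: "x \<in> carrier G"
    and "x [^] int k \<in> P" "x [^] int l \<in> P'" "coprime k l"
  shows "x \<in> P <#> P'"
proof -
  obtain i j where "int k * i + int l * j = 1"
    using \<open>coprime k l\<close> by (metis bezout_int coprime_iff_gcd_eq_1 coprime_int_iff mult.commute)
  then have "x = (x [^] int k) [^] i \<otimes> (x [^] int l) [^] j"
    using x int_pow_mult[of x "int k * i" "int l * j"] by (auto simp: int_pow_pow)
  moreover have "(x [^] int k) [^] i \<in> P" "(x [^] int l) [^] j \<in> P'"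
    using assms by (auto intro: subgroup_int_pow_closed)
  ultimately show ?thesis unfolding set_mult_def by blast
qed

lemma primary_decompositionI:
  assumes p: "prime p" and N: "P \<lhd> G" "P' \<lhd> G"
    and ord_P: "\<And>x. x \<in> P \<Longrightarrow> \<exists>k. ord x = p ^ k" and ord_P': "\<And>y. y \<in> P' \<Longrightarrow> coprime (ord y) p"
    and gen: "carrier G = generate G S" "S \<subseteq> P <#> P'"
  shows "primary_decomposition G p P P'"
proof -
  have sub: "subgroup P G" "subgroup P' G" using N normal_imp_subgroup by blast+
  have "P \<inter> P' \<subseteq> {\<one>}"
  proof
    fix g assume g: "g \<in> P \<inter> P'"
    then obtain k where "ord g = p ^ k" using ord_P by blast
    then have "ord g = 1"
      using ord_P'[of g] g p by (auto simp: coprime_power_left_iff dest: not_prime_unit)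
    then show "g \<in> {\<one>}" using g ord_eq_1 subgroup.mem_carrier[OF sub(1)] by blast
  qed
  then have comm: "x \<otimes> y = y \<otimes> x" if "x \<in> P" "y \<in> P'" for x y
    using normal_imp_commuting[OF N] that by blast
  have PP': "subgroup (P <#> P') G" using N(1) sub(2) by (rule mult_norm_subgroup)
  have "carrier G = P <#> P'"
    using generate_subgroup_incl[OF gen(2) PP'] subgroup.subset[OF PP'] gen(1) by blast
  then show ?thesis
    unfolding primary_decomposition_def primary_decomposition_axioms_def
    using p sub comm ord_P ord_P' is_group by blast
qed

end

lemma (in group) int_pow_conj_self:
  "x \<in> carrier G \<Longrightarrow> inv x \<otimes> x [^] (k::int) \<otimes> x = x [^] k"
  by (simp add: m_assoc int_pow_commute_self)

locale generated_macdonald = macdonald +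
  assumes generated: "carrier G = generate G {A, B}"
    and abs_ge_two: "\<bar>\<alpha>\<bar> \<ge> 2" "\<bar>\<beta>\<bar> \<ge> 2"
begin

lemma ord_generators_pos: "s \<in> {A, B} \<Longrightarrow> ord s > 0"
  using finite_orders[OF abs_ge_two] by blast

lemma gcd_dvd_A_exponents:
  assumes "prime p"
  shows "gcd (int k) (int (ord A)) dvd geom_sum \<alpha> k"
    and "gcd (int (k * p)) (int (ord A)) dvd \<alpha> ^ k - 1"
proof -
  note fin = finite_orders[OF abs_ge_two]
  note primes = prime_dvd_ord_A[OF fin(1,3)]
  show "gcd (int k) (int (ord A)) dvd geom_sum \<alpha> k"
    using fin(1) primes by (rule gcd_dvd_geom_sum)
  show "gcd (int (k * p)) (int (ord A)) dvd \<alpha> ^ k - 1"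
    using fin(1) primes assms by (rule gcd_dvd_power_minus_one)
qed

lemma generated_macdonald_swap: "generated_macdonald G B A \<beta> \<alpha>"
proof -
  interpret swap: macdonald G B A \<beta> \<alpha> by (rule macdonald_swap)
  show ?thesis by unfold_locales (simp_all add: generated abs_ge_two insert_commute)
qed

lemmas gcd_dvd_B_exponents = generated_macdonald.gcd_dvd_A_exponents[OF generated_macdonald_swap]

lemma normal_power_step:
  assumes N: "H \<lhd> G" and p: "prime p"
    and H: "A [^] int (k * p) \<in> H" "B [^] int (k * p) \<in> H" "C [^] int (k * p) \<in> H"
  obtains K where "K \<lhd> G" "A [^] int k \<in> K" "B [^] int k \<in> K" "C [^] int k \<in> K"
    "\<And>g. g \<in> K \<Longrightarrow> g [^] (p ^ 3) \<in> H"
proof -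
  note extension = normal_cyclic_extension[OF generated, where p = p]
  have pow: "(x [^] int k) [^] p = x [^] int (k * p)" if "x \<in> carrier G" for x
    using that by (simp add: int_pow_pow flip: int_pow_int)
  have "A [^] (1 - \<alpha> ^ k) \<in> H" "B [^] (\<beta> ^ k - 1) \<in> H"
    using gcd_dvd_A_exponents(2)[OF p, of k] gcd_dvd_B_exponents(2)[OF p, of k]
      int_pow_mem_if_gcd_dvd[OF normal_imp_subgroup[OF N] A_closed H(1)]
      int_pow_mem_if_gcd_dvd[OF normal_imp_subgroup[OF N] B_closed H(2)]
    by (simp_all add: dvd_diff_commute)
  then have conj_C: "inv s \<otimes> C [^] int k \<otimes> s \<in> K"
    if "s \<in> {A, B}" "subgroup K G" "H \<subseteq> K" "C [^] int k \<in> K" for s K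
    using that subgroup.m_closed[OF that(2)] by (auto simp: C_pow_conj_A C_pow_conj_B)
  obtain H1 where H1: "H1 \<lhd> G" "H \<subseteq> H1" "C [^] int k \<in> H1" "\<And>g. g \<in> H1 \<Longrightarrow> g [^] p \<in> H"
    by (rule extension[OF ord_generators_pos N _ _ conj_C]) (use H(3) in \<open>auto simp: pow\<close>)
  have conj_A: "inv s \<otimes> A [^] int k \<otimes> s \<in> K"
    if "s \<in> {A, B}" "subgroup K G" "H1 \<subseteq> K" "A [^] int k \<in> K" for s K
    using that int_pow_mem_if_gcd_dvd[OF that(2) A_closed that(4), of "\<alpha> * geom_sum \<alpha> k"]
      gcd_dvd_A_exponents(1)[OF p, of k] H1(3) subgroup.m_closed[OF that(2)]
    by (auto simp: A_pow_conj_B int_pow_conj_self)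
  obtain H2 where H2: "H2 \<lhd> G" "H1 \<subseteq> H2" "A [^] int k \<in> H2" "\<And>g. g \<in> H2 \<Longrightarrow> g [^] p \<in> H1"
    by (rule extension[OF ord_generators_pos H1(1) _ _ conj_A]) (use H(1) H1(2) in \<open>auto simp: pow\<close>)
  have conj_B: "inv s \<otimes> B [^] int k \<otimes> s \<in> K"
    if "s \<in> {A, B}" "subgroup K G" "H2 \<subseteq> K" "B [^] int k \<in> K" for s K
    using that int_pow_mem_if_gcd_dvd[OF that(2) B_closed that(4), of "\<beta> * geom_sum \<beta> k"]
      gcd_dvd_B_exponents(1)[OF p, of k] H1(3) H2(2) subgroup.m_closed[OF that(2)]
      subgroup.m_inv_closed[OF that(2)]
    by (auto simp: B_pow_conj_A int_pow_conj_self int_pow_neg)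
  obtain H3 where H3: "H3 \<lhd> G" "H2 \<subseteq> H3" "B [^] int k \<in> H3" "\<And>g. g \<in> H3 \<Longrightarrow> g [^] p \<in> H2"
    by (rule extension[OF ord_generators_pos H2(1) _ _ conj_B])
      (use H(2) H1(2) H2(2) in \<open>auto simp: pow\<close>)
  show ?thesis
  proof
    fix g assume g: "g \<in> H3"
    have "g \<in> carrier G" using g H3(1) by (meson normal_imp_subgroup subgroup.mem_carrier)
    then show "g [^] (p ^ 3) \<in> H"
      using H1(4)[OF H2(4)[OF H3(4)[OF g]]] by (simp add: nat_pow_pow power3_eq_cube)
  qed (use H1 H2 H3 in auto)
qed

lemma normal_power_subgroup:
  assumes "k' > 0" "A [^] int (k * k') = \<one>" "B [^] int (k * k') = \<one>" "C [^] int (k * k') = \<one>"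
  obtains K where "K \<lhd> G" "A [^] int k \<in> K" "B [^] int k \<in> K"
    "\<And>g. g \<in> K \<Longrightarrow> ord g > 0" "\<And>g. g \<in> K \<Longrightarrow> prime_factors (ord g) \<subseteq> prime_factors k'"
proof -
  have "\<exists>K. K \<lhd> G \<and> A [^] int k \<in> K \<and> B [^] int k \<in> K \<and> C [^] int k \<in> K \<and>
      (\<forall>g\<in>K. ord g > 0 \<and> prime_factors (ord g) \<subseteq> prime_factors k')"
    using assms
  proof (induction k' arbitrary: k rule: less_induct)
    case (less k')
    show ?case
    proof (cases "k' = 1")
      case True
      then show ?thesis using less.prems by (intro exI[of _ "{\<one>}"]) (simp add: one_is_normal)
    next
      case False
      then obtain p j where p: "prime p" and k': "k' = p * j" using prime_factor_nat by (metis dvdE)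
      have "j > 0" "j < k'" using k' less.prems(1) prime_gt_1_nat[OF p] by auto
      then obtain H where H: "H \<lhd> G" "A [^] int (k * p) \<in> H" "B [^] int (k * p) \<in> H"
        "C [^] int (k * p) \<in> H" "\<forall>g\<in>H. ord g > 0 \<and> prime_factors (ord g) \<subseteq> prime_factors j"
        using less.IH[of j "k * p"] less.prems by (auto simp: k' mult.assoc)
      obtain K where K: "K \<lhd> G" "A [^] int k \<in> K" "B [^] int k \<in> K" "C [^] int k \<in> K"
        "\<And>g. g \<in> K \<Longrightarrow> g [^] (p ^ 3) \<in> H"
        using normal_power_step[OF H(1) p H(2-4)] by metis
      have "ord g > 0 \<and> prime_factors (ord g) \<subseteq> prime_factors k'" if "g \<in> K" for g
      proof -
        have "g \<in> carrier G" using that K(1) by (meson normal_imp_subgroup subgroup.mem_carrier)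
        moreover have "insert p (prime_factors j) \<subseteq> prime_factors k'"
          using p \<open>j > 0\<close> prime_gt_0_nat[OF p]
          by (auto simp: k' prime_factors_product prime_prime_factors)
        ultimately show ?thesis
          using prime_factors_ord_subset[OF _ p, of g 3] bspec[OF H(5) K(5)[OF that]]
          by (meson insert_mono order_trans)
      qed
      then show ?thesis using K by blast
    qed
  qed
  then show ?thesis using that by blast
qed

theorem primary_decomposition_exists:
  assumes p: "prime p"
  shows "\<exists>P P'. primary_decomposition G p P P'"
proof -
  define L where "L = ord A * ord B * ord C"
  have "L \<noteq> 0" using finite_orders[OF abs_ge_two] by (simp add: L_def)
  then obtain L' where L: "L = p ^ multiplicity p L * L'" "\<not> p dvd L'"
    using multiplicity_decompose'[of L p] p not_prime_unit by metis
  define q where "q = p ^ multiplicity p L"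
  have qL': "q * L' = L" "L' * q = L" using L(1) by (simp_all add: q_def mult.commute)
  then have "q > 0" "L' > 0" using \<open>L \<noteq> 0\<close> by (auto intro: Nat.gr0I)
  have gens: "A [^] int L = \<one>" "B [^] int L = \<one>" "C [^] int L = \<one>"
    by (simp_all add: int_pow_eq_id L_def)
  obtain P where P: "P \<lhd> G" "A [^] int L' \<in> P" "B [^] int L' \<in> P" "\<And>g. g \<in> P \<Longrightarrow> ord g > 0"
      "\<And>g. g \<in> P \<Longrightarrow> prime_factors (ord g) \<subseteq> prime_factors q"
    using normal_power_subgroup[of q L'] gens qL' \<open>q > 0\<close> by metis
  obtain P' where P': "P' \<lhd> G" "A [^] int q \<in> P'" "B [^] int q \<in> P'" "\<And>g. g \<in> P' \<Longrightarrow> ord g > 0"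
      "\<And>g. g \<in> P' \<Longrightarrow> prime_factors (ord g) \<subseteq> prime_factors L'"
    using normal_power_subgroup[of L' q] gens qL' \<open>L' > 0\<close> by metis
  have "primary_decomposition G p P P'"
    using p P(1) P'(1) _ _ generated
  proof (rule primary_decompositionI)
    fix x assume "x \<in> P"
    have "prime_factors q \<subseteq> {p}" using p by (simp add: q_def prime_factorization_prime_power)
    then have "prime_factors (ord x) \<subseteq> {p}" using P(5)[OF \<open>x \<in> P\<close>] by (rule order_trans[rotated])
    then show "\<exists>k. ord x = p ^ k"
      using P(4) \<open>x \<in> P\<close> p by (intro prime_power_if_prime_factors_subset)
  next
    fix y assume "y \<in> P'"
    then have "\<not> p dvd ord y" using P'(4,5) p L(2) by (auto simp: in_prime_factors_iff subset_iff)
    then show "coprime (ord y) p" using p by (simp add: prime_imp_coprime coprime_commute)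
  next
    have "coprime L' q" using prime_imp_coprime[OF p L(2)] by (simp add: q_def coprime_commute)
    then show "{A, B} \<subseteq> P <#> P'"
      using P(1-3) P'(1-3) normal_imp_subgroup
      by (auto intro!: mem_set_mult_if_coprime_powers[where k = L' and l = q])
  qed
  then show ?thesis by blast
qed

end

section \<open>Order bounds in a torsion group\<close>

lemma (in group) int_pow_eq_int_pow_if_coprime:
  fixes k r j m :: int
  assumes x: "x \<in> carrier G" "x [^] m = \<one>" and "coprime r m"
    and y: "y \<in> carrier G" "x [^] (k * r) = y [^] j"
  shows "\<exists>l. x [^] k = y [^] (j * l)"
proof -
  obtain s where s: "[r * s = 1] (mod m)" using cong_solve_coprime_int[OF \<open>coprime r m\<close>] by blast
  have "[k * (r * s) = k * 1] (mod m)" by (intro cong_mult s cong_refl)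
  then have "x [^] k = x [^] (k * r * s)"
    using int_pow_cong[OF x] by (simp add: mult.assoc)
  also have "\<dots> = (x [^] (k * r)) [^] s" using x by (simp add: int_pow_pow)
  also have "\<dots> = y [^] (j * s)" using y by (simp add: int_pow_pow)
  finally show ?thesis by blast
qed

lemma (in group) int_pow_eq_one_if_coprime:
  fixes k r m :: int
  assumes "x \<in> carrier G" "x [^] m = \<one>" "coprime r m" "x [^] (k * r) = \<one>"
  shows "x [^] k = \<one>"
  using int_pow_eq_int_pow_if_coprime[OF assms(1-3) one_closed, of k 0] assms(4) by auto

context macdonald
begin

lemma commutator_A_of_relation:
  assumes rel: "B [^] int y = A [^] int z \<otimes> C [^] int w"
  shows "A [^] (\<alpha> ^ w - 1) = B [^] (int y * \<beta> ^ y - \<beta> * geom_sum \<beta> y) \<otimes> C [^] int y"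
proof -
  let ?g = "\<beta> * geom_sum \<beta> y"
  have "A \<otimes> B [^] int y = A [^] int z \<otimes> (A [^] (1::int) \<otimes> C [^] int w)"
    unfolding rel using int_pow_commute_self[of A "int z"] by (simp add: m_assoc[symmetric])
  also have "\<dots> = B [^] int y \<otimes> A [^] (\<alpha> ^ w)"
    unfolding rel using A_pow_mult_C_pow[of 1 w] by (simp add: m_assoc)
  also have "\<dots> = B [^] int y \<otimes> A \<otimes> A [^] (\<alpha> ^ w - 1)"
    using int_pow_mult[of A 1 "\<alpha> ^ w - 1"] by (simp add: m_assoc)
  finally have "B [^] int y = C [^] (- int y) \<otimes> (B [^] ?g \<otimes> A [^] (\<alpha> ^ w - 1))"
    unfolding B_pow_mult_A by (simp add: m_assoc)
  then have "C [^] int y \<otimes> B [^] int y = B [^] ?g \<otimes> A [^] (\<alpha> ^ w - 1)"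
    by (simp add: int_pow_neg)
  then have "B [^] (- ?g) \<otimes> (B [^] (int y * \<beta> ^ y) \<otimes> C [^] int y)
      = B [^] (- ?g) \<otimes> (B [^] ?g \<otimes> A [^] (\<alpha> ^ w - 1))"
    by (simp add: C_pow_mult_B_pow)
  then show ?thesis by (simp add: int_pow_mult_left)
qed

lemma commutator_C_of_relation:
  fixes x y k s m :: int
  assumes rel: "A [^] x = B [^] y \<otimes> C [^] k" and s: "[\<beta> * s = 1] (mod m)" "B [^] m = \<one>"
  shows "A [^] (x * (\<alpha> - 1)) = B [^] (y * (s - 1))"
proof -
  have "[y * s * \<beta> = y] (mod m)" using cong_mult[OF cong_refl s(1), of y] by (simp add: mult_ac)
  then have "B [^] (y * s * \<beta>) = B [^] y" by (rule int_pow_cong[OF B_closed s(2)])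
  then have B_C: "B [^] y \<otimes> C = C \<otimes> B [^] (y * s)" by (simp add: C_mult_B_pow)
  have "C \<otimes> A [^] (x * \<alpha>) = B [^] y \<otimes> (C [^] k \<otimes> C)"
    unfolding A_pow_mult_C[symmetric] rel by (simp add: m_assoc)
  also have "\<dots> = B [^] y \<otimes> C \<otimes> C [^] k"
    by (simp add: int_pow_commute_self m_assoc)
  also have "\<dots> = C \<otimes> (B [^] (y * s) \<otimes> C [^] k)"
    unfolding B_C by (simp add: m_assoc)
  finally have "A [^] (x * \<alpha>) = B [^] (y * s) \<otimes> C [^] k" by simp
  then have "A [^] (x * \<alpha>) \<otimes> inv (A [^] x) = B [^] (y * s) \<otimes> inv (B [^] y)"
    unfolding rel by (simp add: inv_mult_group m_assoc)
  then show ?thesis by (simp add: right_diff_distrib int_pow_diff)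
qed

end

locale p_torsion_macdonald = macdonald +
  fixes p e k n :: nat and a b :: int
  assumes p: "prime p" "odd p"
    and torsion: "A [^] (int p ^ e) = \<one>" "B [^] (int p ^ e) = \<one>" "C [^] (int p ^ e) = \<one>"
    and \<alpha>_eq: "\<alpha> - 1 = int p ^ k * a" "\<not> int p dvd a" "k \<ge> 1"
    and \<beta>_eq: "\<beta> - 1 = int p ^ n * b" "\<not> int p dvd b" "n \<ge> 1"
begin

lemma p_torsion_macdonald_swap: "p_torsion_macdonald G B A \<beta> \<alpha> p e n k b a"
proof -
  interpret swap: macdonald G B A \<beta> \<alpha> by (rule macdonald_swap)
  show ?thesis
    using p torsion \<alpha>_eq \<beta>_eq by unfold_locales (simp_all add: gcomm_swap int_pow_inv)
qed

lemma coprime_torsion: "coprime r (int p ^ e)" if "\<not> int p dvd r" for r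
  using prime_imp_coprime[of "int p" r] that p(1) by (simp add: coprime_commute)

lemma A_relation_if_relation:
  assumes rel: "B [^] int y = A [^] int z \<otimes> C [^] int w"
    and y: "p ^ m dvd y" and w: "w = p * w'" "\<not> p dvd w'"
  obtains r Y where "A [^] (int p ^ (k + 1) * r) = B [^] (int p ^ (n + m) * Y) \<otimes> C [^] int y"
    "\<not> int p dvd r"
proof -
  have "int p ^ n dvd \<beta> - 1" using \<beta>_eq by simp
  then have "int p ^ (n + m) dvd int y * \<beta> ^ y - \<beta> * geom_sum \<beta> y"
    using p(2) \<beta>_eq(3) y by (intro odd_power_dvd_relation_exponent)
  then obtain Y where "int y * \<beta> ^ y - \<beta> * geom_sum \<beta> y = int p ^ (n + m) * Y" by blast
  moreover obtain r where "\<alpha> ^ w - 1 = int p ^ (k + 1) * r" "\<not> int p dvd r"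
    using lifting_the_exponent[OF p \<alpha>_eq, of w 1 w'] w by auto
  ultimately show ?thesis using commutator_A_of_relation[OF rel] that by metis
qed

lemma B_relation_if_relation:
  assumes rel: "B [^] int y = A [^] int z \<otimes> C [^] int w"
    and z: "p ^ m dvd z" and w: "w = p * w'" "\<not> p dvd w'"
  obtains r Z where "B [^] (int p ^ (n + 1) * r) = A [^] (int p ^ (k + m) * Z) \<otimes> C [^] (- int z)"
    "\<not> int p dvd r"
proof -
  interpret swap: p_torsion_macdonald G B A \<beta> \<alpha> p e n k b a by (rule p_torsion_macdonald_swap)
  have "A [^] int z = B [^] int y \<otimes> gcomm G B A [^] int w"
    unfolding rel gcomm_swap_int_pow by (simp add: m_assoc int_pow_neg)
  then show ?thesis
    using swap.A_relation_if_relation[OF _ z w] that by (auto simp: gcomm_swap_int_pow)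
qed

lemma A_pow_eq_B_pow_if_relation:
  fixes r y l :: int
  assumes rel: "A [^] (int p ^ (k + 1) * r) = B [^] y \<otimes> C [^] l" and r: "\<not> int p dvd r"
  obtains j where "A [^] (int p ^ (2 * k + 1)) = B [^] (y * j)"
proof -
  have "\<not> int p dvd \<beta>"
  proof
    assume "int p dvd \<beta>"
    moreover have "int p dvd \<beta> - 1" using \<beta>_eq by simp
    ultimately have "int p dvd \<beta> - (\<beta> - 1)" by (rule dvd_diff)
    then show False using p(1) not_prime_unit by auto
  qed
  then obtain s where s: "[\<beta> * s = 1] (mod int p ^ e)"
    using cong_solve_coprime_int coprime_torsion by blast
  have "A [^] (int p ^ (k + 1) * r * (\<alpha> - 1)) = B [^] (y * (s - 1))"
    using rel s torsion(2) by (rule commutator_C_of_relation)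
  moreover have "int p ^ (k + 1) * r * (\<alpha> - 1) = int p ^ (2 * k + 1) * (r * a)"
    by (simp add: \<alpha>_eq(1) mult_2 power_add)
  moreover have "\<not> int p dvd r * a" using r \<alpha>_eq(2) p(1) by (simp add: prime_dvd_mult_iff)
  ultimately obtain l where "A [^] (int p ^ (2 * k + 1)) = B [^] (y * (s - 1) * l)"
    using int_pow_eq_int_pow_if_coprime[OF A_closed torsion(1) coprime_torsion B_closed] by metis
  then show ?thesis using that unfolding mult.assoc by blast
qed

lemma B_pow_eq_A_pow_if_relation:
  fixes r z l :: int
  assumes rel: "B [^] (int p ^ (n + 1) * r) = A [^] z \<otimes> C [^] l" and r: "\<not> int p dvd r"
  obtains j where "B [^] (int p ^ (2 * n + 1)) = A [^] (z * j)"
proof -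
  interpret swap: p_torsion_macdonald G B A \<beta> \<alpha> p e n k b a by (rule p_torsion_macdonald_swap)
  have "B [^] (int p ^ (n + 1) * r) = A [^] z \<otimes> gcomm G B A [^] (- l)"
    unfolding rel gcomm_swap_int_pow by simp
  then show ?thesis using r that by (rule swap.A_pow_eq_B_pow_if_relation)
qed

lemma A_pow_eq_one_if_cyclic_relations:
  assumes A_eq: "A [^] (int p ^ (2 * k + 1)) = B [^] (int p ^ (n + 2 * n) * i)"
    and B_eq: "B [^] (int p ^ (2 * n + 1)) = A [^] (int p ^ (k + (2 * k + 1)) * j)"
  shows "A [^] (int p ^ (2 * k + 1)) = \<one>" "B [^] (int p ^ (2 * n + 1)) = \<one>"
proof -
  have n_split: "n + 2 * n = (2 * n + 1) + (n - 1)"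
    and k_split: "k + (2 * k + 1) = (2 * k + 1) + Suc (k - 1)"
    using \<alpha>_eq(3) \<beta>_eq(3) by simp_all
  define l where "l = int p ^ (k - 1) * (j * (int p ^ (n - 1) * i))"
  have "A [^] (int p ^ (2 * k + 1)) = (B [^] (int p ^ (2 * n + 1))) [^] (int p ^ (n - 1) * i)"
    unfolding A_eq unfolding n_split power_add by (simp add: int_pow_pow mult.assoc)
  also have "\<dots> = A [^] (int p ^ (2 * k + 1) * (int p * l))"
    unfolding B_eq unfolding k_split power_add by (simp add: int_pow_pow l_def mult_ac)
  finally have "A [^] (int p ^ (2 * k + 1) * (1 - int p * l)) = \<one>"
    by (simp add: right_diff_distrib int_pow_diff)
  moreover have "\<not> int p dvd 1 - int p * l"
    using prime_gt_1_nat[OF p(1)] by (simp add: dvd_diff_left_iff)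
  ultimately show A_one: "A [^] (int p ^ (2 * k + 1)) = \<one>"
    using int_pow_eq_one_if_coprime[OF A_closed torsion(1) coprime_torsion] by blast
  show "B [^] (int p ^ (2 * n + 1)) = \<one>"
    unfolding B_eq
    by (rule int_pow_eq_one_mono[OF A_closed A_one]) (intro dvd_mult2 le_imp_power_dvd, simp)
qed

lemma order_bounds_if_power_relations:
  fixes r s w y z :: int
  assumes A_C: "A [^] (int p ^ (k + 1) * r) = C [^] y" and r: "\<not> int p dvd r"
    and B_C: "B [^] (int p ^ (n + 1) * s) = C [^] (- z)" and s: "\<not> int p dvd s"
    and C_B: "C [^] (int p * w) = B [^] y" and w: "\<not> int p dvd w"
    and y: "int p ^ (n + 1) dvd y" and z: "(int p)\<^sup>2 dvd z"
  shows "A [^] (int p ^ (k + 1)) = \<one>" "B [^] (int p ^ (n + 1)) = \<one>" "C [^] int p = \<one>"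
proof -
  obtain i where C_p: "C [^] int p = B [^] (y * i)"
    using int_pow_eq_int_pow_if_coprime[OF C_closed torsion(3) coprime_torsion[OF w] B_closed C_B]
    by blast
  obtain y' z' where y': "y = int p ^ (n + 1) * y'" and z': "z = int p * (int p * z')"
    using y z by (metis dvdE mult.assoc power2_eq_square)
  have "B [^] (int p ^ (n + 1) * s) = (C [^] int p) [^] (- (int p * z'))"
    unfolding B_C z' by (simp add: int_pow_pow)
  also have "\<dots> = B [^] (int p ^ (n + 1) * - (int p * (y' * i * z')))"
    unfolding C_p by (simp add: int_pow_pow y' mult_ac)
  finally have "B [^] (int p ^ (n + 1) * (s - - (int p * (y' * i * z')))) = \<one>"
    by (simp only: right_diff_distrib[of "int p ^ (n + 1)"]
        int_pow_diff B_closed r_inv int_pow_closed)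
  moreover have "\<not> int p dvd s - - (int p * (y' * i * z'))" using s by (simp add: dvd_add_left_iff)
  ultimately show B: "B [^] (int p ^ (n + 1)) = \<one>"
    using int_pow_eq_one_if_coprime[OF B_closed torsion(2) coprime_torsion] by blast
  show C: "C [^] int p = \<one>"
    unfolding C_p by (rule int_pow_eq_one_mono[OF B_closed B]) (simp add: y')
  have "C [^] y = \<one>"
    by (rule int_pow_eq_one_mono[OF C_closed C]) (simp add: y')
  then show "A [^] (int p ^ (k + 1)) = \<one>"
    using int_pow_eq_one_if_coprime[OF A_closed torsion(1) coprime_torsion[OF r]] A_C by simp
qed

theorem order_bounds_if_relation:
  assumes rel: "B [^] int y = A [^] int z \<otimes> C [^] int w"
    and y: "p ^ (2 * n) dvd y" and z: "p ^ (2 * k + 1) dvd z" and w: "w = p * w'" "\<not> p dvd w'"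
  shows "A [^] (int p ^ (k + 1)) = \<one>" "B [^] (int p ^ (n + 1)) = \<one>" "C [^] int p = \<one>"
proof -
  obtain r Y
    where A_rel: "A [^] (int p ^ (k + 1) * r) = B [^] (int p ^ (n + 2 * n) * Y) \<otimes> C [^] int y"
    and r: "\<not> int p dvd r" using rel y w by (rule A_relation_if_relation)
  obtain s Z
    where B_rel: "B [^] (int p ^ (n + 1) * s)
      = A [^] (int p ^ (k + (2 * k + 1)) * Z) \<otimes> C [^] (- int z)"
    and s: "\<not> int p dvd s" using rel z w by (rule B_relation_if_relation)
  obtain i where "A [^] (int p ^ (2 * k + 1)) = B [^] (int p ^ (n + 2 * n) * (Y * i))"
    using A_rel r by (rule A_pow_eq_B_pow_if_relation) (simp add: mult.assoc)
  moreover obtain j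
    where "B [^] (int p ^ (2 * n + 1)) = A [^] (int p ^ (k + (2 * k + 1)) * (Z * j))"
    using B_rel s by (rule B_pow_eq_A_pow_if_relation) (simp add: mult.assoc)
  ultimately have bounds: "A [^] (int p ^ (2 * k + 1)) = \<one>" "B [^] (int p ^ (2 * n + 1)) = \<one>"
    by (rule A_pow_eq_one_if_cyclic_relations)+
  note A_one = int_pow_eq_one_mono[OF A_closed bounds(1)]
    and B_one = int_pow_eq_one_mono[OF B_closed bounds(2)]
  have y_dvd: "int p ^ (2 * n) dvd int y" and z_dvd: "int p ^ (2 * k + 1) dvd int z"
    using y z by (metis of_nat_dvd_iff of_nat_power)+
  have "B [^] (int p ^ (n + 2 * n) * Y) = \<one>"
    using \<beta>_eq(3) by (intro B_one dvd_mult2 le_imp_power_dvd) simp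
  then have A_C: "A [^] (int p ^ (k + 1) * r) = C [^] int y" using A_rel by simp
  have "A [^] (int p ^ (k + (2 * k + 1)) * Z) = \<one>"
    by (intro A_one dvd_mult2 le_imp_power_dvd) simp
  then have B_C: "B [^] (int p ^ (n + 1) * s) = C [^] (- int z)" using B_rel by simp
  have C_B: "C [^] (int p * int w') = B [^] int y" using rel w(1) A_one[OF z_dvd] by simp
  have "int p ^ (n + 1) dvd int y"
    using \<beta>_eq(3) by (intro dvd_trans[OF le_imp_power_dvd y_dvd]) simp
  moreover have "(int p)\<^sup>2 dvd int z"
    using \<alpha>_eq(3) by (intro dvd_trans[OF le_imp_power_dvd z_dvd]) simp
  ultimately show "A [^] (int p ^ (k + 1)) = \<one>" "B [^] (int p ^ (n + 1)) = \<one>" "C [^] int p = \<one>"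
    using order_bounds_if_power_relations[OF A_C r B_C s C_B] w(2) by simp_all
qed

end

lemma power_mult_cong_cases:
  fixes q x y v :: int
  assumes "n < m" "[x = y] (mod q ^ m)" "y = q ^ n * v" "\<not> q dvd v"
  obtains w where "x = q ^ n * w" "\<not> q dvd w"
proof -
  obtain l where "x = y + q ^ m * l" using assms(2) by (metis cong_iff_lin cong_sym)
  moreover have "m = n + Suc (m - n - 1)" using assms(1) by simp
  then have "q ^ m = q ^ n * (q * q ^ (m - n - 1))" by (metis power_Suc power_add)
  ultimately have "x = q ^ n * (v + q * (q ^ (m - n - 1) * l))"
    by (simp add: assms(3) algebra_simps)
  moreover have "\<not> q dvd v + q * (q ^ (m - n - 1) * l)"
    using assms(4) by (simp add: dvd_add_left_iff)
  ultimately show ?thesis using that by blast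
qed

lemma (in group) int_pow_eq_nat_exponent:
  fixes i m :: int
  assumes "x \<in> carrier G" "x [^] m = \<one>" "m > 0"
  obtains k :: nat where "x [^] i = x [^] int k" "[int k = i] (mod m)"
proof -
  have "[int (nat (i mod m)) = i] (mod m)" using \<open>m > 0\<close> by (simp add: cong_def)
  then show ?thesis using that int_pow_cong[OF assms(1,2)] cong_sym by metis
qed

context macdonald
begin

lemma B_pow_relation_torsion:
  assumes \<alpha>: "\<alpha> = int t" and \<beta>: "\<beta> - 1 = int u" and m: "A [^] (m::int) = \<one>" "coprime \<alpha> m"
  obtains s where "B [^] (int u * \<beta> ^ (u + 1) - \<beta> * geom_sum \<beta> u)
    = A [^] ((\<alpha> * geom_sum \<alpha> t - \<alpha> ^ (t + 1)) * s) \<otimes> C [^] (\<alpha> - \<beta>)"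
proof -
  let ?y = "int u * \<beta> ^ (u + 1) - \<beta> * geom_sum \<beta> u" and ?x = "\<alpha> * geom_sum \<alpha> t - \<alpha> ^ (t + 1)"
  have "coprime (\<alpha> ^ (1 + t)) m" using m(2) by simp
  then obtain s where "[\<alpha> ^ (1 + t) * s = 1] (mod m)" using cong_solve_coprime_int by blast
  then have "[?x * (\<alpha> ^ (1 + t) * s) = ?x * 1] (mod m)" by (intro cong_mult cong_refl)
  then have "A [^] (?x * s * \<alpha> ^ (1 + t)) = A [^] ?x"
    using int_pow_cong[OF A_closed m(1)] by (simp add: mult_ac)
  then have swap_AC: "C [^] int (1 + t) \<otimes> A [^] ?x = A [^] (?x * s) \<otimes> C [^] int (1 + t)"
    by (simp only: A_pow_mult_C_pow)
  have "\<alpha> ^ 1 = int t" "\<beta> ^ 1 - 1 = int u" using \<alpha> \<beta> by simp_all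
  then have "B [^] ?y = C [^] int (1 + t) \<otimes> A [^] ?x \<otimes> C [^] (- int (u + 1 + 1))"
    using B_pow_relation[of 1 t u] by (simp add: m_assoc add.commute)
  also have "\<dots> = A [^] (?x * s) \<otimes> (C [^] int (1 + t) \<otimes> C [^] (- int (u + 1 + 1)))"
    unfolding swap_AC by (simp add: m_assoc)
  also have "C [^] int (1 + t) \<otimes> C [^] (- int (u + 1 + 1)) = C [^] (\<alpha> - \<beta>)"
    using \<alpha> \<beta> by (simp flip: int_pow_mult) (simp add: algebra_simps)
  finally show ?thesis by (rule that)
qed

lemma relation_3_torsion:
  assumes torsion: "A [^] (3 ^ e :: int) = \<one>" "B [^] (3 ^ e :: int) = \<one>" "C [^] (3 ^ e :: int) = \<one>"
    and \<alpha>: "\<alpha> = int t" "\<alpha> mod 9 = 7"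
    and \<beta>: "\<beta> - 1 = int u" "3 ^ n dvd u" and n: "n \<ge> 2" "2 * n \<le> e" "3 \<le> e"
  obtains y z w :: nat where "B [^] int y = A [^] int z \<otimes> C [^] int w"
    "3 ^ (2 * n) dvd y" "27 dvd z" "w mod 9 = 6"
proof -
  let ?y = "int u * \<beta> ^ (u + 1) - \<beta> * geom_sum \<beta> u" and ?x = "\<alpha> * geom_sum \<alpha> t - \<alpha> ^ (t + 1)"
  have torsion_dvd: "i \<le> e \<Longrightarrow> 3 ^ i dvd (3 ^ e :: int)" for i by (rule le_imp_power_dvd)
  have "\<not> 3 dvd \<alpha>" using \<alpha>(2) by presburger
  then have "coprime \<alpha> (3 ^ e)"
    using prime_imp_coprime[of "3::int" \<alpha>] by (simp add: coprime_commute)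
  then obtain s where rel: "B [^] ?y = A [^] (?x * s) \<otimes> C [^] (\<alpha> - \<beta>)"
    by (rule B_pow_relation_torsion[OF \<alpha>(1) \<beta>(1) torsion(1)])
  obtain y where y: "B [^] ?y = B [^] int y" "[int y = ?y] (mod 3 ^ e)"
    by (rule int_pow_eq_nat_exponent[OF B_closed torsion(2)]) simp_all
  obtain z where z: "A [^] (?x * s) = A [^] int z" "[int z = ?x * s] (mod 3 ^ e)"
    by (rule int_pow_eq_nat_exponent[OF A_closed torsion(1)]) simp_all
  obtain w where w: "C [^] (\<alpha> - \<beta>) = C [^] int w" "[int w = \<alpha> - \<beta>] (mod 3 ^ e)"
    by (rule int_pow_eq_nat_exponent[OF C_closed torsion(3)]) simp_all
  show ?thesis
  proof
    show "B [^] int y = A [^] int z \<otimes> C [^] int w" using rel by (simp only: y(1) z(1) w(1))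
    have u_dvd: "3 ^ n dvd int u" using \<beta>(2) by (metis int_dvd_int_iff of_nat_numeral of_nat_power)
    then have "int 3 ^ (n + n) dvd ?y"
      using \<beta> n by (intro odd_power_dvd_relation_exponent) simp_all
    then have "3 ^ (2 * n) dvd int y"
      using cong_dvd_iff[OF cong_dvd_modulus[OF y(2) torsion_dvd[OF n(2)]]] by (simp add: mult_2)
    then show "3 ^ (2 * n) dvd y" by (metis int_dvd_int_iff of_nat_numeral of_nat_power)
    have "27 dvd ?x" using dvd_27_relation_exponent[of t] \<alpha> by simp
    then have "27 dvd int z"
      using cong_dvd_iff[OF cong_dvd_modulus[OF z(2) torsion_dvd[OF n(3)]]] by simp
    then show "27 dvd z" by presburger
    have "(3::int) ^ 2 dvd 3 ^ n" using n(1) by (rule le_imp_power_dvd)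
    also note u_dvd
    finally have "[\<beta> = 1] (mod 9)" unfolding cong_iff_dvd_diff \<beta>(1) by simp
    moreover have "[\<alpha> = 7] (mod 9)" using \<alpha>(2) by (simp add: cong_def)
    ultimately have "[\<alpha> - \<beta> = 7 - 1] (mod 9)" by (intro cong_diff)
    moreover have "[int w = \<alpha> - \<beta>] (mod 9)"
      using cong_dvd_modulus[OF w(2) torsion_dvd[of 2]] n by simp
    ultimately have "[int w = 6] (mod 9)" using cong_trans by fastforce
    then show "w mod 9 = 6" using zmod_int[of w 9] by (simp add: cong_def)
  qed
qed

lemma order_bounds_positive:
  assumes torsion: "A [^] (3 ^ e :: int) = \<one>" "B [^] (3 ^ e :: int) = \<one>" "C [^] (3 ^ e :: int) = \<one>"
    and \<alpha>: "\<alpha> = int t" "\<alpha> mod 9 = 7"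
    and \<beta>: "\<beta> - 1 = int u" "int u = 3 ^ n * v" "\<not> 3 dvd v" and n: "n \<ge> 2" "2 * n \<le> e" "3 \<le> e"
  shows "A [^] (9::int) = \<one>" "B [^] (3 ^ (n + 1) :: int) = \<one>" "C [^] (3::int) = \<one>"
proof -
  obtain q where "\<alpha> = 7 + 9 * q" using \<alpha>(2) by (metis mod_mult_div_eq add.commute)
  moreover have "\<not> 3 dvd 2 + 3 * q" by presburger
  ultimately interpret three: p_torsion_macdonald G A B \<alpha> \<beta> 3 e 1 n "2 + 3 * q" v
    using torsion \<beta> n by unfold_locales simp_all
  have "3 ^ n dvd u" using \<beta>(2) by (metis dvd_triv_left int_dvd_int_iff of_nat_numeral of_nat_power)
  then obtain y z w where rel: "B [^] int y = A [^] int z \<otimes> C [^] int w"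
    and yzw: "3 ^ (2 * n) dvd y" "27 dvd z" "w mod 9 = 6"
    by (rule relation_3_torsion[OF torsion \<alpha> \<beta>(1) _ n])
  obtain i where "w = 6 + 9 * i" using yzw(3) by (metis mod_mult_div_eq add.commute)
  then have w: "w = 3 * (2 + 3 * i)" by simp
  have "\<not> 3 dvd 2 + 3 * i" by presburger
  then show "A [^] (9::int) = \<one>" "B [^] (3 ^ (n + 1) :: int) = \<one>" "C [^] (3::int) = \<one>"
    using three.order_bounds_if_relation[OF rel _ _ w] yzw(1,2) by simp_all
qed

theorem order_bounds:
  assumes torsion: "A [^] (3 ^ e :: int) = \<one>" "B [^] (3 ^ e :: int) = \<one>"
    and \<alpha>: "\<alpha> mod 9 = 7" and \<beta>: "\<beta> - 1 = 3 ^ n * v" "\<not> 3 dvd v" and n: "n \<ge> 2"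
  shows "A [^] (9::int) = \<one>" "B [^] (3 ^ (n + 1) :: int) = \<one>" "C [^] (3::int) = \<one>"
proof -
  define E where "E = 2 * e + 2 * n + 3"
  have torsion_C: "C [^] int (3 ^ e * 3 ^ e) = \<one>" using torsion(2) by (intro C_pow_eq_one) simp
  have E_ge: "e \<le> E" "2 * e \<le> E" "2 * n \<le> E" "3 \<le> E" "2 \<le> E" by (simp_all add: E_def)
  have "int (3 ^ e * 3 ^ e) = 3 ^ (2 * e)" by (simp add: mult_2 power_add)
  then have "(3 ^ e :: int) dvd 3 ^ E" "int (3 ^ e * 3 ^ e) dvd 3 ^ E"
    using E_ge(1,2) by (simp_all only: le_imp_power_dvd)
  then have torsion_E: "A [^] (3 ^ E :: int) = \<one>" "B [^] (3 ^ E :: int) = \<one>"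
    "C [^] (3 ^ E :: int) = \<one>"
    using int_pow_eq_one_mono[OF A_closed torsion(1)] int_pow_eq_one_mono[OF B_closed torsion(2)]
      int_pow_eq_one_mono[OF C_closed torsion_C] by blast+
  obtain t where t: "A [^] \<alpha> = A [^] int t" "[int t = \<alpha>] (mod 3 ^ E)"
    by (rule int_pow_eq_nat_exponent[OF A_closed torsion_E(1)]) simp_all
  obtain u where u: "B [^] (\<beta> - 1) = B [^] int u" "[int u = \<beta> - 1] (mod 3 ^ E)"
    by (rule int_pow_eq_nat_exponent[OF B_closed torsion_E(2)]) simp_all
  have "B [^] (int u + 1) = B [^] \<beta>"
    using u(1) int_pow_mult[of B "int u" 1] int_pow_mult[of B "\<beta> - 1" 1] by simp
  then interpret positive: macdonald G A B "int t" "int u + 1"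
    using t(1) by unfold_locales (simp_all add: rel_A rel_B)
  have "[int t = \<alpha>] (mod 9)"
    using cong_dvd_modulus[OF t(2) le_imp_power_dvd[OF E_ge(5)]] by simp
  then have "int t mod 9 = 7" using \<alpha> by (simp add: cong_def)
  moreover have "n < E" by (simp add: E_def)
  then obtain v' where "int u = 3 ^ n * v'" "\<not> 3 dvd v'"
    using u(2) \<beta> by (rule power_mult_cong_cases)
  ultimately show "A [^] (9::int) = \<one>" "B [^] (3 ^ (n + 1) :: int) = \<one>" "C [^] (3::int) = \<one>"
    using positive.order_bounds_positive[OF torsion_E HOL.refl _ _ _ _ n E_ge(3,4)] by simp_all
qed

end

section \<open>Central series\<close>

context group
begin

lemma gcomm_mult_left:
  assumes "x \<in> carrier G" "y \<in> carrier G" "z \<in> carrier G"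
  shows "gcomm G (x \<otimes> y) z = inv y \<otimes> gcomm G x z \<otimes> y \<otimes> gcomm G y z"
  using assms by (simp add: gcomm_def inv_mult_group m_assoc)

lemma gcomm_mult_right:
  assumes "x \<in> carrier G" "y \<in> carrier G" "z \<in> carrier G"
  shows "gcomm G x (y \<otimes> z) = gcomm G x z \<otimes> (inv z \<otimes> gcomm G x y \<otimes> z)"
  using assms by (simp add: gcomm_def inv_mult_group m_assoc)

lemma gcomm_inv_left:
  assumes "x \<in> carrier G" "y \<in> carrier G"
  shows "gcomm G (inv x) y = x \<otimes> gcomm G y x \<otimes> inv x"
  using assms by (simp add: gcomm_def m_assoc)

lemma gcomm_inv_right:
  assumes "x \<in> carrier G" "y \<in> carrier G"
  shows "gcomm G x (inv y) = y \<otimes> gcomm G y x \<otimes> inv y"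
  using assms by (simp add: gcomm_def m_assoc)

lemma gcomm_swap_mem:
  assumes "subgroup H G" "x \<in> carrier G" "y \<in> carrier G" "gcomm G x y \<in> H"
  shows "gcomm G y x \<in> H"
  using subgroup.m_inv_closed[OF assms(1,4)] assms(2,3) by (simp add: inv_gcomm)

lemma gcomm_self [simp]: "x \<in> carrier G \<Longrightarrow> gcomm G x x = \<one>"
  by (simp add: gcomm_eq_one_iff)

lemma gcomm_one_right [simp]: "x \<in> carrier G \<Longrightarrow> gcomm G x \<one> = \<one>"
  by (simp add: gcomm_eq_one_iff)

lemma gcomm_generate_mem:
  assumes N: "N \<lhd> G" and x: "x \<in> carrier G" and S: "S \<subseteq> carrier G"
    and gens: "\<And>s. s \<in> S \<Longrightarrow> gcomm G x s \<in> N" and y: "y \<in> generate G S"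
  shows "gcomm G x y \<in> N"
proof -
  interpret N: normal N G by fact
  show ?thesis
    using y
  proof induction
    case one
    show ?case using x by simp
  next
    case (incl s)
    then show ?case by (rule gens)
  next
    case (inv s)
    then have s: "s \<in> carrier G" using S by blast
    have "gcomm G s x \<in> N" using N.subgroup_axioms x s gens[OF inv] by (rule gcomm_swap_mem)
    then show ?case unfolding gcomm_inv_right[OF x s] using s by (rule N.inv_op_closed2[rotated])
  next
    case (eng y z)
    then have yz: "y \<in> carrier G" "z \<in> carrier G" using S generate_in_carrier by auto
    then show ?case
      unfolding gcomm_mult_right[OF x yz] using eng.IH N.inv_op_closed1 by simp
  qed
qed

definition central_mod :: "'a set \<Rightarrow> 'a set" where
  "central_mod N = {x \<in> carrier G. \<forall>y\<in>carrier G. gcomm G x y \<in> N}"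

abbreviation "center \<equiv> central_mod {\<one>}"

lemma center_commute:
  assumes "x \<in> center" "y \<in> carrier G"
  shows "x \<otimes> y = y \<otimes> x"
proof -
  have "x \<in> carrier G" "gcomm G x y = \<one>" using assms by (simp_all add: central_mod_def)
  then show ?thesis using gcomm_eq_one_iff assms(2) by blast
qed

lemma central_mod_generateI:
  assumes "N \<lhd> G" "carrier G = generate G S" "x \<in> carrier G" "\<And>s. s \<in> S \<Longrightarrow> gcomm G x s \<in> N"
  shows "x \<in> central_mod N"
proof -
  have "S \<subseteq> carrier G" unfolding assms(2) by (auto intro: generate.incl)
  then show ?thesis
    using assms by (auto simp: central_mod_def intro: gcomm_generate_mem)
qed

lemma normal_subset_central_mod:
  assumes "N \<lhd> G"
  shows "N \<subseteq> central_mod N"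
proof
  interpret N: normal N G by fact
  fix x assume x: "x \<in> N"
  have "gcomm G x y \<in> N" if "y \<in> carrier G" for y
    using x that N.inv_op_closed1[of y x] by (simp add: gcomm_def m_assoc)
  then show "x \<in> central_mod N" using x by (simp add: central_mod_def)
qed

lemma central_mod_normal:
  assumes "N \<lhd> G"
  shows "central_mod N \<lhd> G"
proof -
  interpret N: normal N G by fact
  have sub: "subgroup (central_mod N) G"
  proof (rule subgroupI)
    show "central_mod N \<noteq> {}" using normal_subset_central_mod[OF assms] N.one_closed by blast
    show "inv x \<in> central_mod N" if "x \<in> central_mod N" for x
      using that N.inv_op_closed2 gcomm_swap_mem[OF N.subgroup_axioms]
      by (auto simp: central_mod_def gcomm_inv_left)
    show "x \<otimes> y \<in> central_mod N" if "x \<in> central_mod N" "y \<in> central_mod N" for x y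
      using that N.inv_op_closed1 by (auto simp: central_mod_def gcomm_mult_left)
  qed (auto simp: central_mod_def)
  then show ?thesis
  proof (rule normal_invI)
    fix x g assume g: "g \<in> carrier G" and x: "x \<in> central_mod N"
    then have "gcomm G x (inv g) \<in> central_mod N"
      using normal_subset_central_mod[OF assms] by (auto simp: central_mod_def)
    moreover have "g \<otimes> x \<otimes> inv g = x \<otimes> gcomm G x (inv g)"
      using g x by (simp add: central_mod_def gcomm_def m_assoc)
    ultimately show "g \<otimes> x \<otimes> inv g \<in> central_mod N"
      using subgroup.m_closed[OF sub x] by simp
  qed
qed

lemma gcomm_mem_commsub: "x \<in> U \<Longrightarrow> y \<in> V \<Longrightarrow> gcomm G x y \<in> commsub G U V"
  unfolding commsub_def gcomm_def by (rule generate.incl) auto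

lemma lcs_Suc_subset:
  assumes "subgroup N G" "lcs G i \<subseteq> central_mod N"
  shows "lcs G (Suc i) \<subseteq> N"
  unfolding lcs.simps commsub_def
  by (rule generate_subgroup_incl[OF _ assms(1)])
     (use assms(2) in \<open>auto simp: central_mod_def gcomm_def\<close>)

lemma one_mem_lcs: "\<one> \<in> lcs G i"
  by (cases i) (simp_all add: commsub_def generate.one)

lemma lcs_eq_one_mono:
  assumes "lcs G i = {\<one>}" "i \<le> j"
  shows "lcs G j = {\<one>}"
  using assms(2)
proof (induction rule: dec_induct)
  case (step j)
  have "lcs G j \<subseteq> center" unfolding step.IH by (simp add: central_mod_def gcomm_def)
  then have "lcs G (Suc j) \<subseteq> {\<one>}" by (rule lcs_Suc_subset[OF triv_subgroup])
  then show ?case using one_mem_lcs by blast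
qed (rule assms)

lemma nilpotency_class_isI:
  assumes "lcs G (Suc c) = {\<one>}" "lcs G c \<noteq> {\<one>}"
  shows "nilpotency_class_is G (Suc c)"
  unfolding nilpotency_class_is_def using assms lcs_eq_one_mono less_Suc_eq_le by blast

lemma carrier_subset_central_mod_if_generators:
  assumes N: "N \<lhd> G" and gen: "carrier G = generate G S"
    and comm: "\<And>s t. s \<in> S \<Longrightarrow> t \<in> S \<Longrightarrow> gcomm G s t \<in> N"
  shows "carrier G \<subseteq> central_mod N"
proof -
  have "S \<subseteq> central_mod N"
    using comm by (auto intro!: central_mod_generateI[OF N gen] simp: gen intro: generate.incl)
  then show ?thesis
    unfolding gen
    by (rule generate_subgroup_incl[OF _ normal_imp_subgroup[OF central_mod_normal[OF N]]])
qed

end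

section \<open>The group with bounded orders\<close>

locale bounded_macdonald = macdonald +
  fixes n :: nat and v :: int
  assumes generated: "carrier G = generate G {A, B}"
    and A_9: "A [^] (9::int) = \<one>" and B_n: "B [^] (3 ^ (n + 1) :: int) = \<one>"
    and C_3: "C [^] (3::int) = \<one>"
    and \<alpha>_mod: "\<alpha> mod 9 = 7" and \<beta>_eq: "\<beta> - 1 = 3 ^ n * v" and n: "n \<ge> 1"
begin

lemma three_dvd_one_minus_\<alpha>: "3 dvd 1 - \<alpha>"
  using \<alpha>_mod by presburger

lemma centerI:
  assumes "z \<in> carrier G" "z \<otimes> A = A \<otimes> z" "z \<otimes> B = B \<otimes> z"
  shows "z \<in> center"
  by (rule central_mod_generateI[OF one_is_normal generated])
     (use assms in \<open>auto simp: gcomm_eq_one_iff\<close>)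

lemma A_pow_mem_center:
  assumes "3 dvd m"
  shows "A [^] (m::int) \<in> center"
proof -
  obtain l where m: "m = 3 * l" using assms by blast
  have "geom_sum \<alpha> 3 = 1 + \<alpha> + \<alpha> * \<alpha>" by (simp add: geom_sum_def numeral_3_eq_3)
  moreover have "[\<alpha> * (1 + \<alpha> + \<alpha> * \<alpha>) = 7 * (1 + 7 + 7 * 7)] (mod 9)"
    using \<alpha>_mod by (intro cong_mult cong_add cong_refl) (simp_all add: cong_def)
  ultimately have "[\<alpha> * geom_sum \<alpha> 3 = 3] (mod 9)" by (simp add: cong_def)
  then have "A [^] (\<alpha> * geom_sum \<alpha> 3) = A [^] (3::int)" by (rule int_pow_cong[OF A_closed A_9])
  then have "A [^] (3::int) \<otimes> B = B \<otimes> A [^] (3::int)" using A_pow_mult_B[of 3] C_3 by simp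
  then have "(A [^] (3::int)) [^] l \<otimes> B = B \<otimes> (A [^] (3::int)) [^] l" by (simp add: int_pow_commute)
  then show ?thesis by (intro centerI) (simp_all add: m int_pow_pow int_pow_commute_self)
qed

lemma B_pow_mem_center:
  assumes "3 ^ n dvd m"
  shows "B [^] (m::int) \<in> center"
proof -
  obtain l where m: "m = 3 ^ n * l" using assms by blast
  have "[\<beta> * geom_sum \<beta> (3 ^ n) = int (3 ^ n) * \<beta> ^ 0] (mod 3 ^ (n + n))"
    using odd_power_dvd_relation_exponent[of 3 n \<beta> n "3 ^ n" 0] \<beta>_eq n
    by (simp add: cong_iff_dvd_diff dvd_diff_commute)
  moreover have "(3::int) ^ (n + 1) dvd 3 ^ (n + n)" using n by (intro le_imp_power_dvd) simp
  ultimately have "[\<beta> * geom_sum \<beta> (3 ^ n) = 3 ^ n] (mod 3 ^ (n + 1))"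
    by (auto dest: cong_dvd_modulus)
  then have "B [^] (\<beta> * geom_sum \<beta> (3 ^ n)) = B [^] (3 ^ n :: int)"
    by (rule int_pow_cong[OF B_closed B_n])
  moreover have "C [^] (- int (3 ^ n)) = \<one>"
    by (rule int_pow_eq_one_mono[OF C_closed C_3]) (use n in simp)
  ultimately have "B [^] (3 ^ n :: int) \<otimes> A = A \<otimes> B [^] (3 ^ n :: int)"
    using B_pow_mult_A[of "3 ^ n"] by simp
  then have "(B [^] (3 ^ n :: int)) [^] l \<otimes> A = A \<otimes> (B [^] (3 ^ n :: int)) [^] l"
    by (simp add: int_pow_commute)
  then show ?thesis by (intro centerI) (simp_all add: m int_pow_pow int_pow_commute_self)
qed

lemma gcomm_C_A: "gcomm G C A = A [^] (1 - \<alpha>)"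
proof (rule gcomm_eqI)
  show "C \<otimes> A = A \<otimes> (C \<otimes> A [^] (1 - \<alpha>))"
    using A_pow_mult_C[of 1] int_pow_mult[of A \<alpha> "1 - \<alpha>"]
    by (simp add: m_assoc[symmetric]) (simp add: m_assoc)
qed simp_all

lemma gcomm_C_B: "gcomm G C B = B [^] (\<beta> - 1)"
proof (rule gcomm_eqI)
  have "B [^] (\<beta> - 1) \<in> center" using \<beta>_eq by (intro B_pow_mem_center) simp
  then show "C \<otimes> B = B \<otimes> (C \<otimes> B [^] (\<beta> - 1))"
    using C_pow_mult_B[of 1] by (simp add: center_commute)
qed simp_all

lemma C_central_mod_center: "C \<in> central_mod center"
proof (rule central_mod_generateI[OF _ generated])
  show "center \<lhd> G" by (intro central_mod_normal one_is_normal)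
  show "gcomm G C s \<in> center" if "s \<in> {A, B}" for s
    using that three_dvd_one_minus_\<alpha> \<beta>_eq
    by (auto simp: gcomm_C_A gcomm_C_B A_pow_mem_center B_pow_mem_center)
qed simp

theorem nilpotency_class_three:
  assumes "A [^] (1 - \<alpha>) \<noteq> \<one>"
  shows "nilpotency_class_is G 3"
proof -
  let ?Z = "central_mod center"
  have Z: "center \<lhd> G" "?Z \<lhd> G" by (intro central_mod_normal one_is_normal)+
  have "gcomm G B A \<in> ?Z"
    using gcomm_swap_mem[OF normal_imp_subgroup[OF Z(2)] _ _ C_central_mod_center] by simp
  then have "carrier G \<subseteq> central_mod ?Z"
    using C_central_mod_center subgroup.one_closed[OF normal_imp_subgroup[OF Z(2)]]
    by (intro carrier_subset_central_mod_if_generators[OF Z(2) generated]) auto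
  then have "lcs G (Suc 0) \<subseteq> ?Z" by (intro lcs_Suc_subset[OF normal_imp_subgroup[OF Z(2)]]) simp
  then have "lcs G (Suc (Suc 0)) \<subseteq> center" by (rule lcs_Suc_subset[OF normal_imp_subgroup[OF Z(1)]])
  then have "lcs G (Suc (Suc (Suc 0))) \<subseteq> {\<one>}" by (rule lcs_Suc_subset[OF triv_subgroup])
  then have "lcs G (Suc (Suc (Suc 0))) = {\<one>}" using one_mem_lcs by blast
  moreover have "C \<in> lcs G (Suc 0)" using gcomm_mem_commsub[of A "carrier G" B] by simp
  then have "gcomm G C A \<in> lcs G (Suc (Suc 0))"
    unfolding lcs.simps(2)[of G "Suc 0"] by (rule gcomm_mem_commsub) simp
  then have "lcs G (Suc (Suc 0)) \<noteq> {\<one>}" using assms by (auto simp: gcomm_C_A)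
  ultimately show ?thesis
    unfolding numeral_3_eq_3 by (rule nilpotency_class_isI)
qed

definition normal_form :: "nat \<times> nat \<times> nat \<Rightarrow> 'a" where
  "normal_form = (\<lambda>(i, j, k). A [^] int i \<otimes> (B [^] int j \<otimes> C [^] int k))"

lemma normal_form_cases:
  fixes i j k :: int
  assumes "x = A [^] i \<otimes> (B [^] j \<otimes> C [^] k)"
  obtains p where "p \<in> {..<9} \<times> {..<3 ^ (n + 1)} \<times> {..<3}" "x = normal_form p"
proof
  let ?p = "(nat (i mod 9), nat (j mod 3 ^ (n + 1)), nat (k mod 3))"
  show "?p \<in> {..<9} \<times> {..<3 ^ (n + 1)} \<times> {..<3}" by (simp add: nat_less_iff)
  have "A [^] i = A [^] (i mod 9)" by (rule int_pow_cong[OF A_closed A_9]) (simp add: cong_def)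
  moreover have "B [^] j = B [^] (j mod 3 ^ (n + 1))"
    by (rule int_pow_cong[OF B_closed B_n]) (simp add: cong_def)
  moreover have "C [^] k = C [^] (k mod 3)"
    by (rule int_pow_cong[OF C_closed C_3]) (simp add: cong_def)
  ultimately show "x = normal_form ?p" by (simp add: normal_form_def assms)
qed

lemma normal_form_mult_B:
  "normal_form (i, j, k) \<otimes> B = A [^] int i \<otimes> (B [^] (int j + \<beta> ^ k) \<otimes> C [^] int k)"
  using C_pow_mult_B_pow[of k 1] by (simp add: normal_form_def m_assoc int_pow_mult)

lemma normal_form_mult_A:
  "\<exists>i' j' k'. normal_form (i, j, k) \<otimes> A = A [^] (i'::int) \<otimes> (B [^] (j'::int) \<otimes> C [^] (k'::int))"
proof -
  let ?z = "A [^] (1 - \<alpha> ^ k)"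
  have "3 dvd 1 - \<alpha> ^ k"
    using three_dvd_one_minus_\<alpha> minus_one_dvd_power_minus_one[of \<alpha> k]
    by (metis dvd_diff_commute dvd_trans)
  then have z: "?z \<otimes> g = g \<otimes> ?z" if "g \<in> carrier G" for g
    using center_commute[OF A_pow_mem_center] that by blast
  obtain l where l: "C [^] (- int j) = C [^] int l"
    by (rule int_pow_eq_nat_exponent[OF C_closed C_3]) simp_all
  have "C [^] int k \<otimes> A = A \<otimes> (C [^] int k \<otimes> ?z)"
    using C_pow_conj_A[of k] by (simp add: m_assoc inv_solve_left')
  then have "normal_form (i, j, k) \<otimes> A = A [^] int i \<otimes> (B [^] int j \<otimes> A \<otimes> (?z \<otimes> C [^] int k))"
    by (simp add: normal_form_def m_assoc z)
  also have "B [^] int j \<otimes> A = A \<otimes> (B [^] (\<beta> * geom_sum \<beta> j * \<beta> ^ l) \<otimes> C [^] int l)"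
      (is "_ = A \<otimes> ?bc")
    unfolding B_pow_mult_A l C_pow_mult_B_pow ..
  also have "A [^] int i \<otimes> (A \<otimes> ?bc \<otimes> (?z \<otimes> C [^] int k))
      = A [^] int i \<otimes> A \<otimes> (?bc \<otimes> ?z) \<otimes> C [^] int k"
    by (simp add: m_assoc)
  also have "?bc \<otimes> ?z = ?z \<otimes> ?bc" by (rule z[symmetric]) simp
  also have "A [^] int i \<otimes> A \<otimes> (?z \<otimes> ?bc) \<otimes> C [^] int k
      = A [^] (int (Suc i) + (1 - \<alpha> ^ k))
        \<otimes> (B [^] (\<beta> * geom_sum \<beta> j * \<beta> ^ l) \<otimes> C [^] (int l + int k))"
    unfolding int_pow_Suc(1)[OF A_closed, symmetric]
    by (simp add: m_assoc int_pow_mult del: of_nat_Suc)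
  finally show ?thesis by blast
qed

lemma carrier_eq_normal_forms: "carrier G = normal_form ` ({..<9} \<times> {..<3 ^ (n + 1)} \<times> {..<3})"
  (is "_ = normal_form ` ?box")
proof
  show "carrier G \<subseteq> normal_form ` ?box"
  proof
    fix x assume "x \<in> carrier G"
    then have "x \<in> generate G {A, B}" by (simp add: generated)
    then show "x \<in> normal_form ` ?box"
    proof (induction rule: torsion_generate_induct)
      case (torsion s)
      then show ?case
        using ord_pos_if_int_pow_eq_one[OF A_closed A_9] ord_pos_if_int_pow_eq_one[OF B_closed B_n]
        by auto
    next
      case one
      show ?case by (rule normal_form_cases[of \<one> 0 0 0]) auto
    next
      case (mult x s)
      then obtain i j k where x: "x = normal_form (i, j, k)" by auto
      consider "s = A" | "s = B" using mult by blast
      then obtain i' j' k' where "x \<otimes> s = A [^] (i'::int) \<otimes> (B [^] (j'::int) \<otimes> C [^] (k'::int))"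
        using normal_form_mult_A[of i j k] normal_form_mult_B[of i j k] x by cases blast+
      then show ?case by (rule normal_form_cases) auto
    qed simp
  qed
qed (auto simp: normal_form_def)

lemma card_carrier_le: "finite (carrier G)" "card (carrier G) \<le> 3 ^ (n + 4)"
proof -
  let ?box = "{..<9} \<times> {..<3 ^ (n + 1)} \<times> {..<3} :: (nat \<times> nat \<times> nat) set"
  have finite_box: "finite ?box" "card ?box = 3 ^ (n + 4)"
    by (simp_all add: card_cartesian_product power_add)
  show "finite (carrier G)" "card (carrier G) \<le> 3 ^ (n + 4)"
    unfolding carrier_eq_normal_forms
    using finite_box card_image_le[OF finite_box(1), of normal_form] by simp_all
qed

end

section \<open>The presented group\<close>

lemma linv_linv [simp]: "linv (linv x) = x"
  by (simp add: linv_def)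

lemma winv_Nil [simp]: "winv [] = []"
  by (simp add: winv_def)

lemma winv_append [simp]: "winv (u @ v) = winv v @ winv u"
  by (simp add: winv_def)

lemma winv_winv [simp]: "winv (winv u) = u"
  by (induction u) (simp_all add: winv_def rev_map)

lemma weq_append:
  assumes "weq \<alpha> \<beta> u u'" "weq \<alpha> \<beta> v v'"
  shows "weq \<alpha> \<beta> (u @ v) (u' @ v')"
proof (rule weq.trans)
  show "weq \<alpha> \<beta> (u @ v) (u' @ v)" using weq.ctxt[OF assms(1), of "[]" v] by simp
  show "weq \<alpha> \<beta> (u' @ v) (u' @ v')" using weq.ctxt[OF assms(2), of u' "[]"] by simp
qed

lemma weq_append_winv: "weq \<alpha> \<beta> (u @ winv u) []"
proof (induction u)
  case (Cons x u)
  have "weq \<alpha> \<beta> ([x] @ (u @ winv u) @ [linv x]) ([x] @ [] @ [linv x])"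
    using Cons by (rule weq.ctxt)
  then have "weq \<alpha> \<beta> ((x # u) @ winv (x # u)) [x, linv x]" by (simp add: winv_def)
  then show ?case using weq.cancel by (rule weq.trans)
qed (simp add: weq.refl)

lemma wclass_eq_iff: "wclass \<alpha> \<beta> u = wclass \<alpha> \<beta> v \<longleftrightarrow> weq \<alpha> \<beta> u v"
  unfolding wclass_def using weq.refl weq.sym weq.trans by blast

lemma wmult_wclass: "wmult \<alpha> \<beta> (wclass \<alpha> \<beta> u) (wclass \<alpha> \<beta> v) = wclass \<alpha> \<beta> (u @ v)"
proof
  show "wmult \<alpha> \<beta> (wclass \<alpha> \<beta> u) (wclass \<alpha> \<beta> v) \<subseteq> wclass \<alpha> \<beta> (u @ v)"
    unfolding wmult_def wclass_def using weq_append weq.trans by blast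
  show "wclass \<alpha> \<beta> (u @ v) \<subseteq> wmult \<alpha> \<beta> (wclass \<alpha> \<beta> u) (wclass \<alpha> \<beta> v)"
    unfolding wmult_def wclass_def using weq.refl by blast
qed

lemma carrier_presG: "carrier (presG \<alpha> \<beta>) = range (wclass \<alpha> \<beta>)"
  by (simp add: presG_def)

lemma wclass_closed [simp]: "wclass \<alpha> \<beta> u \<in> carrier (presG \<alpha> \<beta>)"
  unfolding carrier_presG by (rule rangeI)

lemma presG_simps:
  "wclass \<alpha> \<beta> u \<otimes>\<^bsub>presG \<alpha> \<beta>\<^esub> wclass \<alpha> \<beta> v = wclass \<alpha> \<beta> (u @ v)"
  "\<one>\<^bsub>presG \<alpha> \<beta>\<^esub> = wclass \<alpha> \<beta> []"
  by (simp_all add: presG_def wmult_wclass)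

lemma group_presG: "group (presG \<alpha> \<beta>)"
proof (rule groupI)
  fix x assume "x \<in> carrier (presG \<alpha> \<beta>)"
  then obtain u where u: "x = wclass \<alpha> \<beta> u" by (auto simp: carrier_presG)
  have "wclass \<alpha> \<beta> (winv u @ u) = wclass \<alpha> \<beta> []"
    using weq_append_winv[of \<alpha> \<beta> "winv u"] by (simp add: wclass_eq_iff)
  then show "\<exists>y\<in>carrier (presG \<alpha> \<beta>). y \<otimes>\<^bsub>presG \<alpha> \<beta>\<^esub> x = \<one>\<^bsub>presG \<alpha> \<beta>\<^esub>"
    unfolding u by (intro bexI[of _ "wclass \<alpha> \<beta> (winv u)"]) (simp_all add: presG_simps)
qed (auto simp: carrier_presG presG_simps)

lemma inv_wclass: "inv\<^bsub>presG \<alpha> \<beta>\<^esub> wclass \<alpha> \<beta> u = wclass \<alpha> \<beta> (winv u)"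
proof -
  interpret group "presG \<alpha> \<beta>" by (rule group_presG)
  show ?thesis
    using weq_append_winv[of \<alpha> \<beta> "winv u"]
    by (intro inv_equality) (simp_all add: presG_simps wclass_eq_iff)
qed

lemma wclass_nat_pow: "wclass \<alpha> \<beta> u [^]\<^bsub>presG \<alpha> \<beta>\<^esub> (k::nat) = wclass \<alpha> \<beta> (concat (replicate k u))"
proof (induction k)
  case (Suc k)
  have "concat (replicate (Suc k) u) = concat (replicate k u) @ u"
    by (simp add: replicate_append_same[symmetric] del: replicate_append_same)
  then show ?case using Suc by (simp add: presG_simps)
qed (simp add: presG_simps)

lemma wclass_int_pow: "wclass \<alpha> \<beta> u [^]\<^bsub>presG \<alpha> \<beta>\<^esub> (k::int) = wclass \<alpha> \<beta> (wpow u k)"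
proof -
  interpret group "presG \<alpha> \<beta>" by (rule group_presG)
  show ?thesis
  proof (cases "k \<ge> 0")
    case True
    then have "wclass \<alpha> \<beta> u [^]\<^bsub>presG \<alpha> \<beta>\<^esub> k = wclass \<alpha> \<beta> u [^]\<^bsub>presG \<alpha> \<beta>\<^esub> nat k"
      by (metis int_pow_int nat_0_le)
    then show ?thesis using True by (simp add: wclass_nat_pow wpow_def)
  next
    case False
    then have k: "wclass \<alpha> \<beta> u [^]\<^bsub>presG \<alpha> \<beta>\<^esub> k
        = (inv\<^bsub>presG \<alpha> \<beta>\<^esub> wclass \<alpha> \<beta> u) [^]\<^bsub>presG \<alpha> \<beta>\<^esub> int (nat (- k))"
      by (simp add: int_pow_inv int_pow_neg)
    show ?thesis
      unfolding k int_pow_int inv_wclass wclass_nat_pow using False by (simp add: wpow_def)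
  qed
qed

lemma gcomm_wclass:
  "gcomm (presG \<alpha> \<beta>) (wclass \<alpha> \<beta> u) (wclass \<alpha> \<beta> v) = wclass \<alpha> \<beta> (winv u @ winv v @ u @ v)"
  by (simp add: gcomm_def inv_wclass presG_simps)

lemma macdonald_presG: "macdonald (presG \<alpha> \<beta>) (wclass \<alpha> \<beta> wA) (wclass \<alpha> \<beta> wB) \<alpha> \<beta>"
proof -
  interpret group "presG \<alpha> \<beta>" by (rule group_presG)
  have C: "gcomm (presG \<alpha> \<beta>) (wclass \<alpha> \<beta> wA) (wclass \<alpha> \<beta> wB) = wclass \<alpha> \<beta> wC"
    by (simp add: gcomm_wclass wC_def)
  show ?thesis
    by unfold_locales
       (simp_all add: C inv_wclass wclass_int_pow presG_simps wclass_eq_iff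
         weq.rel1[simplified] weq.rel2[simplified])
qed

lemma wclass_letter_mem_generate:
  "wclass \<alpha> \<beta> [x] \<in> generate (presG \<alpha> \<beta>) {wclass \<alpha> \<beta> wA, wclass \<alpha> \<beta> wB}" (is "_ \<in> generate _ ?S")
proof -
  obtain g e where x: "x = (g, e)" by (metis surj_pair)
  have mem: "wclass \<alpha> \<beta> [(g, False)] \<in> ?S" by (cases g) (simp_all add: wA_def wB_def)
  show ?thesis
  proof (cases e)
    case True
    then have "wclass \<alpha> \<beta> [x] = inv\<^bsub>presG \<alpha> \<beta>\<^esub> wclass \<alpha> \<beta> [(g, False)]"
      by (simp add: x inv_wclass winv_def linv_def)
    then show ?thesis using generate.inv[OF mem] by simp
  next
    case False
    then show ?thesis using generate.incl[OF mem] x by simp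
  qed
qed

lemma presG_generated: "carrier (presG \<alpha> \<beta>) = generate (presG \<alpha> \<beta>) {wclass \<alpha> \<beta> wA, wclass \<alpha> \<beta> wB}"
  (is "_ = generate ?G ?S")
proof
  interpret group ?G by (rule group_presG)
  show "generate ?G ?S \<subseteq> carrier ?G" by (rule generate_incl) simp
  have "wclass \<alpha> \<beta> w \<in> generate ?G ?S" for w
  proof (induction w)
    case Nil
    show ?case using generate.one[of ?G ?S] by (simp add: presG_simps)
  next
    case (Cons x w)
    show ?case
      using generate.eng[OF wclass_letter_mem_generate[of \<alpha> \<beta> x] Cons] by (simp add: presG_simps)
  qed
  then show "carrier ?G \<subseteq> generate ?G ?S" by (auto simp: carrier_presG)
qed

context macdonald
begin

definition letter_value :: "letter \<Rightarrow> 'a" where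
  "letter_value l = (let g = if fst l then B else A in if snd l then inv g else g)"

primrec word_value :: "letter list \<Rightarrow> 'a" where
  "word_value [] = \<one>"
| "word_value (l # w) = letter_value l \<otimes> word_value w"

lemma letter_value_closed [simp]: "letter_value l \<in> carrier G"
  by (simp add: letter_value_def Let_def)

lemma letter_value_linv: "letter_value (linv l) = inv (letter_value l)"
  by (simp add: letter_value_def linv_def Let_def)

lemma word_value_closed [simp]: "word_value w \<in> carrier G"
  by (induction w) simp_all

lemma word_value_append: "word_value (u @ w) = word_value u \<otimes> word_value w"
  by (induction u) (simp_all add: m_assoc)

lemma word_value_winv: "word_value (winv w) = inv (word_value w)"
proof (induction w)
  case (Cons l w)
  have "winv (l # w) = winv w @ [linv l]" by (simp add: winv_def)
  then show ?case by (simp add: word_value_append Cons letter_value_linv inv_mult_group)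
qed simp

lemma word_value_concat_replicate: "word_value (concat (replicate k w)) = word_value w [^] k"
proof (induction k)
  case (Suc k)
  then show ?case using nat_pow_Suc2[of "word_value w" k] by (simp add: word_value_append)
qed simp

lemma word_value_wpow: "word_value (wpow w k) = word_value w [^] k"
  by (simp add: wpow_def word_value_concat_replicate word_value_winv int_pow_inv int_pow_neg)

lemma word_value_generators: "word_value wA = A" "word_value wB = B" "word_value wC = C"
  by (simp_all add: wA_def wB_def wC_def winv_def linv_def letter_value_def gcomm_def m_assoc)

lemma word_value_eq_if_weq: "weq \<alpha> \<beta> u w \<Longrightarrow> word_value u = word_value w"
proof (induction rule: weq.induct)
  case rel1
  show ?case
    using rel_A
    by (simp add: word_value_append word_value_winv word_value_wpow word_value_generators m_assoc)
next
  case rel2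
  show ?case
    using rel_B
    by (simp add: word_value_append word_value_winv word_value_wpow word_value_generators m_assoc)
qed (simp_all add: word_value_append letter_value_linv)

theorem presG_hom:
  obtains h where "group_hom (presG \<alpha> \<beta>) G h"
    "h (wclass \<alpha> \<beta> wA) = A" "h (wclass \<alpha> \<beta> wB) = B"
proof
  let ?h = "\<lambda>U. word_value (SOME w. w \<in> U)"
  have h: "?h (wclass \<alpha> \<beta> w) = word_value w" for w
  proof -
    have "w \<in> wclass \<alpha> \<beta> w" by (simp add: wclass_def weq.refl)
    then have "(SOME u. u \<in> wclass \<alpha> \<beta> w) \<in> wclass \<alpha> \<beta> w" by (rule someI)
    then show ?thesis unfolding wclass_def using word_value_eq_if_weq by simp
  qed
  show "?h (wclass \<alpha> \<beta> wA) = A" "?h (wclass \<alpha> \<beta> wB) = B"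
    by (simp_all only: h word_value_generators)
  have "?h \<in> hom (presG \<alpha> \<beta>) G"
    by (auto simp: hom_def carrier_presG presG_simps h word_value_append)
  then show "group_hom (presG \<alpha> \<beta>) G ?h"
    by (simp add: group_hom_def group_hom_axioms_def group_presG is_group)
qed

end

section \<open>A model of the Sylow 3-subgroup\<close>

type_synonym triple = "int \<times> int \<times> int"

definition a_twist :: "int \<Rightarrow> int \<Rightarrow> int \<Rightarrow> int" where
  "a_twist j k r = r * k + (r * r - r) * j"

definition b_twist :: "int \<Rightarrow> int \<Rightarrow> int \<Rightarrow> int \<Rightarrow> int" where
  "b_twist j k r s = s * (k - r * j) - r * (j - j * j)"

text \<open>The product of the normal forms \<open>a\<^sup>ib\<^sup>jc\<^sup>k\<close> and \<open>a\<^sup>rb\<^sup>sc\<^sup>t\<close>, where \<open>\<xi> = \<beta> - 1\<close> and the exponents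
  are read modulo \<open>9\<close>, \<open>3\<^bsup>n+1\<^esup>\<close> and \<open>3\<close>. The factor \<open>j - j\<^sup>2\<close> in \<open>b_twist\<close> stands for the binomial
  coefficient \<open>j(j-1)/2\<close>, to which it is congruent modulo \<open>3\<close>.\<close>
fun triple_mult :: "int \<Rightarrow> triple \<Rightarrow> triple \<Rightarrow> triple" where
  "triple_mult \<xi> (i, j, k) (r, s, t) =
    (i + r + 3 * a_twist j k r, j + s + \<xi> * b_twist j k r s, k + t - r * j)"

fun triple_reduce :: "nat \<Rightarrow> triple \<Rightarrow> triple" where
  "triple_reduce n (i, j, k) = (i mod 9, j mod 3 ^ (n + 1), k mod 3)"

declare triple_reduce.simps [simp del]

definition triple_group :: "nat \<Rightarrow> int \<Rightarrow> triple monoid" where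
  "triple_group n \<xi> = \<lparr>carrier = {0..<9} \<times> {0..<3 ^ (n + 1)} \<times> {0..<3},
    monoid.mult = \<lambda>p q. triple_reduce n (triple_mult \<xi> p q), one = (0, 0, 0)\<rparr>"

lemma cong_mult_3_mod_9: "[a = b] (mod 3) \<Longrightarrow> [3 * a = 3 * b] (mod (9::int))"
  by (auto simp: cong_iff_dvd_diff elim!: dvdE) (simp flip: right_diff_distrib)

lemma a_twist_cong:
  "[j = j'] (mod 3) \<Longrightarrow> [k = k'] (mod 3) \<Longrightarrow> [r = r'] (mod 3)
    \<Longrightarrow> [a_twist j k r = a_twist j' k' r'] (mod 3)"
  unfolding a_twist_def by (intro cong_add cong_mult cong_diff)

lemma b_twist_cong:
  "[j = j'] (mod 3) \<Longrightarrow> [k = k'] (mod 3) \<Longrightarrow> [r = r'] (mod 3) \<Longrightarrow> [s = s'] (mod 3)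
    \<Longrightarrow> [b_twist j k r s = b_twist j' k' r' s'] (mod 3)"
  unfolding b_twist_def by (intro cong_mult cong_diff)

lemma a_twist_assoc:
  assumes "[js = j + s] (mod 3)" "[ru = r + u] (mod 3)"
  shows "[a_twist j k r + a_twist js (k + t - r * j) u = a_twist s t u + a_twist j k ru] (mod 3)"
proof -
  have "[a_twist j k r + a_twist js (k + t - r * j) u
      = a_twist j k r + a_twist (j + s) (k + t - r * j) u] (mod 3)"
    by (intro cong_add cong_refl a_twist_cong assms)
  also have "a_twist j k r + a_twist (j + s) (k + t - r * j) u
      = a_twist s t u + a_twist j k (r + u) + 3 * - (r * u * j)"
    by (simp add: a_twist_def algebra_simps)
  also have "[\<dots> = a_twist s t u + a_twist j k ru + 0] (mod 3)"
    by (intro cong_add cong_refl a_twist_cong assms[THEN cong_sym]) (simp add: cong_0_iff)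
  finally show ?thesis by simp
qed

lemma b_twist_assoc:
  assumes "[js = j + s] (mod 3)" "[ru = r + u] (mod 3)" "[sw = s + w] (mod 3)"
  shows "[b_twist j k r s + b_twist js (k + t - r * j) u w
    = b_twist s t u w + b_twist j k ru sw] (mod 3)"
proof -
  have "[b_twist j k r s + b_twist js (k + t - r * j) u w
      = b_twist j k r s + b_twist (j + s) (k + t - r * j) u w] (mod 3)"
    by (intro cong_add cong_refl b_twist_cong assms)
  also have "b_twist j k r s + b_twist (j + s) (k + t - r * j) u w
      = b_twist s t u w + b_twist j k (r + u) (s + w) + 3 * (u * j * s)"
    by (simp add: b_twist_def algebra_simps)
  also have "[\<dots> = b_twist s t u w + b_twist j k ru sw + 0] (mod 3)"
    by (intro cong_add cong_refl b_twist_cong assms[THEN cong_sym]) (simp add: cong_0_iff)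
  finally show ?thesis by simp
qed

lemma c_exponent_assoc:
  fixes j s :: int
  assumes "[js = j + s] (mod 3)" "[ru = r + u] (mod 3)"
  shows "[k + t - r * j + x - u * js = k + (t + x - u * s) - ru * j] (mod 3)"
proof -
  have "[k + t - r * j + x - u * js = k + t - r * j + x - u * (j + s)] (mod 3)"
    by (intro cong_diff cong_mult cong_refl assms)
  also have "k + t - r * j + x - u * (j + s) = k + (t + x - u * s) - (r + u) * j"
    by (simp add: algebra_simps)
  also have "[\<dots> = k + (t + x - u * s) - ru * j] (mod 3)"
    by (intro cong_diff cong_mult cong_refl assms[THEN cong_sym])
  finally show ?thesis .
qed

locale triple_model =
  fixes n :: nat and v \<xi> :: int
  assumes n: "n \<ge> 1" and \<xi>: "\<xi> = 3 ^ n * v"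
begin

abbreviation "K \<equiv> triple_group n \<xi>"
abbreviation "red \<equiv> triple_reduce n"
abbreviation mul where "mul \<equiv> triple_mult \<xi>"

lemma red_eq_iff:
  "red (i, j, k) = red (i', j', k') \<longleftrightarrow>
    [i = i'] (mod 9) \<and> [j = j'] (mod 3 ^ (n + 1)) \<and> [k = k'] (mod 3)"
  by (simp add: triple_reduce.simps cong_def)

lemma red_red [simp]: "red (red p) = red p"
  by (cases p) (simp add: triple_reduce.simps)

lemma red_closed [simp]: "red p \<in> carrier K"
  by (cases p) (simp add: triple_reduce.simps triple_group_def)

lemma red_carrier: "p \<in> carrier K \<Longrightarrow> red p = p"
  by (auto simp: triple_reduce.simps triple_group_def)

lemma mult_eq: "p \<otimes>\<^bsub>K\<^esub> q = red (mul p q)"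
  by (simp add: triple_group_def)

lemma one_eq: "\<one>\<^bsub>K\<^esub> = red (0, 0, 0)"
  by (simp add: triple_reduce.simps triple_group_def)

lemma cong_mod_3:
  fixes a b :: int
  shows "[a = b] (mod 9) \<Longrightarrow> [a = b] (mod 3)" "[a = b] (mod 3 ^ (n + 1)) \<Longrightarrow> [a = b] (mod 3)"
  by (erule cong_dvd_modulus, simp)+

lemma cong_mult_\<xi>:
  assumes "[a = b] (mod 3)"
  shows "[\<xi> * a = \<xi> * b] (mod 3 ^ (n + 1))"
proof -
  have "3 ^ n * 3 dvd \<xi> * (a - b)"
    using assms by (intro mult_dvd_mono) (simp_all add: \<xi> cong_iff_dvd_diff)
  then show ?thesis by (simp add: cong_iff_dvd_diff right_diff_distrib mult.commute)
qed

lemma cong_add_mult_mod_3: "[a + 3 * b = a] (mod 3)" "[a + \<xi> * b = a] (mod 3)" for a b :: int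
  using n by (simp_all add: \<xi> cong_iff_dvd_diff dvd_mult2 dvd_power)

lemma red_mul_cong:
  assumes "red p = red p'" "red q = red q'"
  shows "red (mul p q) = red (mul p' q')"
proof -
  obtain i j k i' j' k' where p: "p = (i, j, k)" "p' = (i', j', k')" by (metis surj_pair)
  obtain r s t r' s' t' where q: "q = (r, s, t)" "q' = (r', s', t')" by (metis surj_pair)
  have congs: "[i = i'] (mod 9)" "[j = j'] (mod 3 ^ (n + 1))" "[k = k'] (mod 3)"
    "[r = r'] (mod 9)" "[s = s'] (mod 3 ^ (n + 1))" "[t = t'] (mod 3)"
    using assms unfolding p q red_eq_iff by blast+
  note congs_mod_3 =
    cong_mod_3(2)[OF congs(2)] cong_mod_3(1)[OF congs(4)] cong_mod_3(2)[OF congs(5)]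
  show ?thesis
    unfolding p q triple_mult.simps red_eq_iff
    by (intro conjI cong_add cong_diff cong_mult_3_mod_9 cong_mult_\<xi> a_twist_cong b_twist_cong
        cong_mult congs congs_mod_3)
qed

lemma red_mul_red [simp]:
  "red (mul (red p) q) = red (mul p q)" "red (mul p (red q)) = red (mul p q)"
  by (rule red_mul_cong; simp)+

lemma red_mul_assoc: "red (mul (mul p q) r) = red (mul p (mul q r))"
proof -
  obtain i j k where p: "p = (i, j, k)" by (metis surj_pair)
  obtain i' j' k' where q: "q = (i', j', k')" by (metis surj_pair)
  obtain u w x where r: "r = (u, w, x)" by (metis surj_pair)
  define J where "J = j + j' + \<xi> * b_twist j k i' j'"
  define U where "U = i' + u + 3 * a_twist j' k' u"
  define W where "W = j' + w + \<xi> * b_twist j' k' u w"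
  let ?K = "k + k' - i' * j"
  have sums_mod_3: "[J = j + j'] (mod 3)" "[U = i' + u] (mod 3)" "[W = j' + w] (mod 3)"
    unfolding J_def U_def W_def by (rule cong_add_mult_mod_3)+
  have "i + i' + 3 * a_twist j k i' + u + 3 * a_twist J ?K u
      = i + i' + u + 3 * (a_twist j k i' + a_twist J ?K u)" by simp
  also have "[\<dots> = i + i' + u + 3 * (a_twist j' k' u + a_twist j k U)] (mod 9)"
    by (intro cong_add cong_refl cong_mult_3_mod_9 a_twist_assoc sums_mod_3)
  also have "i + i' + u + 3 * (a_twist j' k' u + a_twist j k U) = i + U + 3 * a_twist j k U"
    by (simp add: U_def)
  finally have a_exponent: "[i + i' + 3 * a_twist j k i' + u + 3 * a_twist J ?K u
      = i + U + 3 * a_twist j k U] (mod 9)" .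
  have "J + w + \<xi> * b_twist J ?K u w = j + j' + w + \<xi> * (b_twist j k i' j' + b_twist J ?K u w)"
    by (simp add: J_def distrib_left)
  also have "[\<dots> = j + j' + w + \<xi> * (b_twist j' k' u w + b_twist j k U W)] (mod 3 ^ (n + 1))"
    by (intro cong_add cong_refl cong_mult_\<xi> b_twist_assoc sums_mod_3)
  also have "j + j' + w + \<xi> * (b_twist j' k' u w + b_twist j k U W) = j + W + \<xi> * b_twist j k U W"
    by (simp add: W_def distrib_left)
  finally have "[J + w + \<xi> * b_twist J ?K u w = j + W + \<xi> * b_twist j k U W] (mod 3 ^ (n + 1))" .
  then show ?thesis
    using a_exponent c_exponent_assoc[OF sums_mod_3(1,2)]
    unfolding p q r triple_mult.simps red_eq_iff J_def U_def W_def by blast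
qed

lemma mult_assoc: "p \<otimes>\<^bsub>K\<^esub> q \<otimes>\<^bsub>K\<^esub> r = p \<otimes>\<^bsub>K\<^esub> (q \<otimes>\<^bsub>K\<^esub> r)"
  by (simp add: mult_eq red_mul_assoc)

lemma zero_mult: "(0, 0, 0) \<otimes>\<^bsub>K\<^esub> p = red p"
  by (cases p) (simp add: mult_eq a_twist_def b_twist_def)

lemma red_eq_mult: "red (i, j, k) = (i, 0, 0) \<otimes>\<^bsub>K\<^esub> ((0, j, 0) \<otimes>\<^bsub>K\<^esub> (0, 0, k))"
  by (simp add: mult_eq a_twist_def b_twist_def)

lemma powers_add:
  "(i, 0, 0) \<otimes>\<^bsub>K\<^esub> (i', 0, 0) = red (i + i', 0, 0)" "(0, i, 0) \<otimes>\<^bsub>K\<^esub> (0, i', 0) = red (0, i + i', 0)"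
  "(0, 0, i) \<otimes>\<^bsub>K\<^esub> (0, 0, i') = red (0, 0, i + i')"
  by (simp_all add: mult_eq a_twist_def b_twist_def)

lemma mult_red [simp]: "p \<otimes>\<^bsub>K\<^esub> red q = p \<otimes>\<^bsub>K\<^esub> q" "red p \<otimes>\<^bsub>K\<^esub> q = p \<otimes>\<^bsub>K\<^esub> q"
  by (simp_all add: mult_eq)

sublocale group K
proof (rule groupI)
  show "\<one>\<^bsub>K\<^esub> \<otimes>\<^bsub>K\<^esub> p = p" if "p \<in> carrier K" for p
    using that by (simp add: one_eq zero_mult red_carrier)
  show "\<exists>q\<in>carrier K. q \<otimes>\<^bsub>K\<^esub> p = \<one>\<^bsub>K\<^esub>" if p: "p \<in> carrier K" for p
  proof -
    obtain i j k where ijk: "p = (i, j, k)" by (metis surj_pair)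
    have cancel: "(- i, 0, 0) \<otimes>\<^bsub>K\<^esub> ((i, 0, 0) \<otimes>\<^bsub>K\<^esub> r) = red r"
      "(0, - j, 0) \<otimes>\<^bsub>K\<^esub> ((0, j, 0) \<otimes>\<^bsub>K\<^esub> r) = red r" for r
      by (simp_all add: powers_add zero_mult flip: mult_assoc)
    have "(0, 0, - k) \<otimes>\<^bsub>K\<^esub> ((0, - j, 0) \<otimes>\<^bsub>K\<^esub> (- i, 0, 0)) \<otimes>\<^bsub>K\<^esub> red p = \<one>\<^bsub>K\<^esub>"
      unfolding ijk red_eq_mult by (simp add: mult_assoc cancel powers_add one_eq)
    then show ?thesis
      unfolding red_carrier[OF p] by (rule bexI) (simp add: mult_eq)
  qed
qed (simp_all add: mult_eq one_eq red_mul_assoc)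

lemma int_pow_eq:
  "red (1, 0, 0) [^]\<^bsub>K\<^esub> (l::int) = red (l, 0, 0)" "red (0, 1, 0) [^]\<^bsub>K\<^esub> l = red (0, l, 0)"
  "red (0, 0, 1) [^]\<^bsub>K\<^esub> l = red (0, 0, l)"
  using int_pow_additive[where f = "\<lambda>i. red (i, 0, 0)"]
    int_pow_additive[where f = "\<lambda>i. red (0, i, 0)"]
    int_pow_additive[where f = "\<lambda>i. red (0, 0, i)"]
  by (simp_all only: powers_add mult_red red_closed)

lemma gcomm_eq: "gcomm K (red (1, 0, 0)) (red (0, 1, 0)) = red (0, 0, 1)"
  by (rule gcomm_eqI) (simp_all add: mult_eq a_twist_def b_twist_def)

lemma macdonald_model:
  assumes \<alpha>: "\<alpha> mod 9 = 7"
  shows "macdonald K (red (1, 0, 0)) (red (0, 1, 0)) \<alpha> (1 + \<xi>)"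
proof -
  let ?a = "red (1, 0, 0)" and ?b = "red (0, 1, 0)" and ?c = "red (0, 0, 1)"
  obtain q where q: "\<alpha> = 7 + 9 * q" using \<alpha> by (metis mod_mult_div_eq add.commute)
  have "[1 = \<alpha> + 3 * \<alpha>] (mod 9)" by (simp add: q cong_iff_dvd_diff)
  then have "?a \<otimes>\<^bsub>K\<^esub> ?c = ?c \<otimes>\<^bsub>K\<^esub> (?a [^]\<^bsub>K\<^esub> \<alpha>)"
    unfolding int_pow_eq mult_red mult_eq
    by (simp add: red_eq_iff a_twist_def b_twist_def)
  moreover have "?c \<otimes>\<^bsub>K\<^esub> ?b = (?b [^]\<^bsub>K\<^esub> (1 + \<xi>)) \<otimes>\<^bsub>K\<^esub> ?c"
    unfolding int_pow_eq mult_red mult_eq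
    by (simp add: a_twist_def b_twist_def)
  ultimately show ?thesis
    by (intro macdonaldI) (simp_all only: gcomm_eq red_closed)
qed

lemma card_carrier: "card (carrier K) = 3 ^ (n + 4)"
  by (simp add: triple_group_def card_cartesian_product power_add nat_mult_distrib nat_power_eq)

end

section \<open>The Sylow 3-subgroup\<close>

context primary_decomposition
begin

lemma Syl_torsion:
  assumes "x \<in> carrier Syl"
  shows "\<exists>k. x [^]\<^bsub>Syl\<^esub> (int p ^ k) = \<one>\<^bsub>Syl\<^esub>"
proof -
  have x: "x \<in> P" using assms by (simp add: pelems_eq)
  then obtain k where "ord x = p ^ k" using ord_P by blast
  then have "x [^] (int p ^ k) = \<one>" using x by (simp add: int_pow_eq_id)
  then show ?thesis using int_pow_consistent[OF subgroups(1) x] by (auto simp: pelems_eq)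
qed

lemma hom_from_Syl:
  assumes "group_hom G K h" "order K = p ^ m"
  shows "group_hom Syl K h" "g \<in> carrier G \<Longrightarrow> h (ppart p G g) = h g"
proof -
  interpret h: group_hom G K h by fact
  have "h \<in> hom Syl K" by (auto simp: hom_def pelems_eq)
  then show "group_hom Syl K h"
    using ppart.H.is_group h.H.is_group by (simp add: group_hom_def group_hom_axioms_def)
  assume g: "g \<in> carrier G"
  obtain y where y: "y \<in> P'" "g = ppart p G g \<otimes> y" using g by (rule decompose_ppart)
  have "h y [^]\<^bsub>K\<^esub> ord y = \<one>\<^bsub>K\<^esub>" using y(1) by (simp flip: h.hom_nat_pow)
  then have "h.H.ord (h y) dvd ord y" using y(1) by (simp add: h.H.pow_eq_id)
  moreover have "h.H.ord (h y) dvd p ^ m"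
    using h.H.ord_dvd_group_order[of "h y"] y(1) assms(2) by simp
  moreover have "coprime (ord y) (p ^ m)" using ord_P'[OF y(1)] by simp
  ultimately have "h.H.ord (h y) = 1" by (meson coprime_common_divisor nat_dvd_1_iff_1)
  then have "h y = \<one>\<^bsub>K\<^esub>" using h.H.ord_eq_1 y(1) h.hom_closed P'.mem_carrier by blast
  then have "h (ppart p G g \<otimes> y) = h (ppart p G g)"
    using y(1) g ppart_mem by simp
  then show "h (ppart p G g) = h g" using y(2) by simp
qed

end

lemma (in generated_macdonald) bounded_macdonald_Sylow:
  assumes dec: "primary_decomposition G 3 P P'"
    and \<alpha>: "\<alpha> mod 9 = 7" and \<beta>: "\<beta> - 1 = 3 ^ n * v" "\<not> 3 dvd v" and n: "n \<ge> 2"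
  shows "bounded_macdonald (G\<lparr>carrier := pelems 3 G\<rparr>) (ppart 3 G A) (ppart 3 G B) \<alpha> \<beta> n v"
proof -
  interpret primary_decomposition G 3 P P' by fact
  interpret Syl: macdonald Syl "ppart 3 G A" "ppart 3 G B" \<alpha> \<beta>
    by (rule macdonald_hom_image) (rule ppart.group_hom_axioms)
  obtain k l where kl: "ppart 3 G A [^]\<^bsub>Syl\<^esub> (int 3 ^ k) = \<one>\<^bsub>Syl\<^esub>"
    "ppart 3 G B [^]\<^bsub>Syl\<^esub> (int 3 ^ l) = \<one>\<^bsub>Syl\<^esub>"
    using Syl_torsion Syl.A_closed Syl.B_closed by blast
  have "ppart 3 G A [^]\<^bsub>Syl\<^esub> (3 ^ (k + l) :: int) = \<one>\<^bsub>Syl\<^esub>"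
    "ppart 3 G B [^]\<^bsub>Syl\<^esub> (3 ^ (k + l) :: int) = \<one>\<^bsub>Syl\<^esub>"
    using ppart.H.int_pow_eq_one_mono[OF Syl.A_closed kl(1)]
      ppart.H.int_pow_eq_one_mono[OF Syl.B_closed kl(2)]
    by (simp_all add: power_add)
  note bounds = Syl.order_bounds[OF this \<alpha> \<beta> n]
  have "carrier Syl = generate Syl {ppart 3 G A, ppart 3 G B}"
    using ppart.generate_img[of "{A, B}"]
    unfolding ppart_image[symmetric] generated[symmetric] by simp
  then show ?thesis
    using bounds \<alpha> \<beta> n by unfold_locales simp_all
qed

lemma (in generated_macdonald) ppart_gcomm:
  assumes "prime p" "x \<in> carrier G" "y \<in> carrier G"
  shows "ppart p G (gcomm G x y) = gcomm (G\<lparr>carrier := pelems p G\<rparr>) (ppart p G x) (ppart p G y)"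
proof -
  obtain P P' where "primary_decomposition G p P P'"
    using primary_decomposition_exists assms(1) by blast
  then interpret primary_decomposition G p P P' .
  show ?thesis using assms(2,3) by (rule ppart.hom_gcomm)
qed

locale macdonald_onto_model = bounded_macdonald +
  fixes h :: "'a \<Rightarrow> triple"
  assumes h_hom: "group_hom G (triple_group n (\<beta> - 1)) h"
    and h_A: "h A = triple_reduce n (1, 0, 0)" and h_B: "h B = triple_reduce n (0, 1, 0)"
begin

sublocale model: triple_model n v "\<beta> - 1"
  using \<beta>_eq n by unfold_locales

sublocale h: group_hom G model.K h
  by (rule h_hom)

lemma h_C: "h C = triple_reduce n (0, 0, 1)"
  by (simp add: h.hom_gcomm h_A h_B model.gcomm_eq)

lemma h_pow:
  "h (A [^] (i::int)) = triple_reduce n (i, 0, 0)" "h (B [^] i) = triple_reduce n (0, i, 0)"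
  "h (C [^] i) = triple_reduce n (0, 0, i)"
  by (simp_all only: h.hom_int_pow A_closed B_closed C_closed h_A h_B h_C model.int_pow_eq)

lemma triple_reduce_eq_h_one_iff:
  "triple_reduce n (i, j, k) = h \<one> \<longleftrightarrow> 9 dvd i \<and> 3 ^ (n + 1) dvd j \<and> 3 dvd k"
  by (simp only: h.hom_one model.one_eq model.red_eq_iff cong_0_iff)

lemma ord_A: "ord A = 9"
proof (rule ord_eqI)
  fix m assume "A [^] int m = \<one>"
  then have "int 9 dvd int m" using h_pow(1)[of "int m"] triple_reduce_eq_h_one_iff[of "int m" 0 0]
    by simp
  then show "9 dvd m" by (simp only: int_dvd_int_iff)
qed (use A_9 in simp_all)

lemma ord_B: "ord B = 3 ^ (n + 1)"
proof (rule ord_eqI)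
  fix m assume "B [^] int m = \<one>"
  then have "int (3 ^ (n + 1)) dvd int m"
    using h_pow(2)[of "int m"] triple_reduce_eq_h_one_iff[of 0 "int m" 0] by simp
  then show "3 ^ (n + 1) dvd m" by (simp only: int_dvd_int_iff)
qed (use B_n in simp_all)

lemma ord_C: "ord C = 3"
proof (rule ord_eqI)
  fix m assume "C [^] int m = \<one>"
  then have "int 3 dvd int m" using h_pow(3)[of "int m"] triple_reduce_eq_h_one_iff[of 0 0 "int m"]
    by simp
  then show "3 dvd m" by (simp only: int_dvd_int_iff)
qed (use C_3 in simp_all)

lemma nilpotency_class_eq: "nilpotency_class_is G 3"
proof (rule nilpotency_class_three)
  have "\<not> 9 dvd 1 - \<alpha>" using \<alpha>_mod by presburger
  then show "A [^] (1 - \<alpha>) \<noteq> \<one>" by (simp add: int_pow_eq_id ord_A)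
qed

lemma h_surj: "carrier model.K \<subseteq> h ` carrier G"
proof
  fix p assume p: "p \<in> carrier model.K"
  obtain i j k where ijk: "p = (i, j, k)" by (metis surj_pair)
  have "p = triple_reduce n (i, j, k)" using model.red_carrier[OF p] ijk by simp
  also have "\<dots> = h (A [^] i \<otimes> (B [^] j \<otimes> C [^] k))"
    unfolding model.red_eq_mult by (simp add: h_pow)
  finally show "p \<in> h ` carrier G" by (rule image_eqI) simp
qed

lemma card_carrier: "card (carrier G) = 3 ^ (n + 4)"
  using surj_card_le[OF card_carrier_le(1) h_surj] card_carrier_le(2)
  by (simp add: model.card_carrier)

end

lemma presG_hom_to_model:
  assumes \<alpha>: "\<alpha> mod 9 = 7" and \<beta>: "\<beta> - 1 = 3 ^ n * v" and n: "n \<ge> 1"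
  obtains h where "group_hom (presG \<alpha> \<beta>) (triple_group n (\<beta> - 1)) h"
    "h (wclass \<alpha> \<beta> wA) = triple_reduce n (1, 0, 0)" "h (wclass \<alpha> \<beta> wB) = triple_reduce n (0, 1, 0)"
proof -
  interpret model: triple_model n v "\<beta> - 1" using \<beta> n by unfold_locales
  interpret macdonald model.K "triple_reduce n (1, 0, 0)" "triple_reduce n (0, 1, 0)" \<alpha> \<beta>
    using model.macdonald_model[OF \<alpha>] by simp
  show ?thesis by (rule presG_hom) (rule that)
qed

lemma (in generated_macdonald) macdonald_onto_model_Sylow:
  assumes \<alpha>: "\<alpha> mod 9 = 7" and \<beta>: "\<beta> - 1 = 3 ^ n * v" "\<not> 3 dvd v" and n: "n \<ge> 2"
    and h: "group_hom G (triple_group n (\<beta> - 1)) h"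
      "h A = triple_reduce n (1, 0, 0)" "h B = triple_reduce n (0, 1, 0)"
  shows "macdonald_onto_model (G\<lparr>carrier := pelems 3 G\<rparr>) (ppart 3 G A) (ppart 3 G B) \<alpha> \<beta> n v h"
proof -
  have "prime (3::nat)" by simp
  then obtain P P' where decomposition: "primary_decomposition G 3 P P'"
    using primary_decomposition_exists by blast
  interpret primary_decomposition G 3 P P' by fact
  interpret Syl: bounded_macdonald Syl "ppart 3 G A" "ppart 3 G B" \<alpha> \<beta> n v
    using decomposition \<alpha> \<beta> n by (rule bounded_macdonald_Sylow)
  interpret model: triple_model n v "\<beta> - 1" using \<beta> n by unfold_locales simp_all
  have "order model.K = 3 ^ (n + 4)" by (simp add: order_def model.card_carrier)
  note h_Syl = hom_from_Syl[OF h(1) this]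
  show ?thesis using h_Syl h(2,3) by unfold_locales (simp_all add: group_hom.axioms group_hom_def)
qed

lemma mod_9_eq_1_decompose:
  fixes \<beta> :: int
  defines "n \<equiv> multiplicity 3 (\<beta> - 1)"
  assumes "\<beta> \<noteq> 1" "\<beta> mod 9 = 1"
  obtains v where "\<beta> - 1 = 3 ^ n * v" "\<not> 3 dvd v" "n \<ge> 2"
proof -
  have "3\<^sup>2 dvd \<beta> - 1" using assms(3) by (simp add: mod_eq_dvd_iff[symmetric])
  then have "n \<ge> 2" unfolding n_def using assms(2) by (intro multiplicity_geI) auto
  then show ?thesis
    using that multiplicity_decompose'[of "\<beta> - 1" 3] assms(2) unfolding n_def by auto
qed

lemma generated_macdonald_presG:
  assumes "\<bar>\<alpha>\<bar> \<ge> 2" "\<bar>\<beta>\<bar> \<ge> 2"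
  shows "generated_macdonald (presG \<alpha> \<beta>) (wclass \<alpha> \<beta> wA) (wclass \<alpha> \<beta> wB) \<alpha> \<beta>"
  using assms macdonald_presG presG_generated
  by (simp add: generated_macdonald_def generated_macdonald_axioms_def)

theorem theorem10p2:
  fixes \<alpha> \<beta> :: int
  assumes "\<beta> \<noteq> 1" and "\<alpha> mod 9 = 7" and "\<beta> mod 9 = 1"
  defines "G \<equiv> presG \<alpha> \<beta>"
      and "n \<equiv> multiplicity (3::int) (\<beta> - 1)"
  defines "A \<equiv> wclass \<alpha> \<beta> wA" and "B \<equiv> wclass \<alpha> \<beta> wB"
  defines "C \<equiv> wclass \<alpha> \<beta> wC"
  defines "G3 \<equiv> G\<lparr>carrier := pelems 3 G\<rparr>"
  defines "a \<equiv> ppart 3 G A" and "b \<equiv> ppart 3 G B" and "c \<equiv> ppart 3 G C"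
  shows "card (carrier G3) = 3 ^ (n + 4)
       \<and> nilpotency_class_is G3 3
       \<and> group.ord G3 a = 9
       \<and> group.ord G3 b = 3 ^ (n + 1)
       \<and> group.ord G3 c = 3"
proof -
  obtain v where v: "\<beta> - 1 = 3 ^ n * v" "\<not> 3 dvd v" and n: "n \<ge> 2"
    unfolding n_def using assms(1,3) by (rule mod_9_eq_1_decompose)
  have "\<bar>\<alpha>\<bar> \<ge> 2" "\<bar>\<beta>\<bar> \<ge> 2" using assms(1-3) by presburger+
  then interpret G: generated_macdonald G A B \<alpha> \<beta>
    unfolding G_def A_def B_def by (rule generated_macdonald_presG)
  have "n \<ge> 1" using n by simp
  with assms(2) v(1) obtain h where "group_hom G (triple_group n (\<beta> - 1)) h"
    "h A = triple_reduce n (1, 0, 0)" "h B = triple_reduce n (0, 1, 0)"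
    unfolding G_def A_def B_def by (rule presG_hom_to_model)
  with assms(2) v n interpret G3: macdonald_onto_model G3 a b \<alpha> \<beta> n v h
    unfolding G3_def a_def b_def by (rule G.macdonald_onto_model_Sylow)
  have "C = gcomm G A B" unfolding C_def G_def A_def B_def by (simp add: gcomm_wclass wC_def)
  then have "c = gcomm G3 a b" unfolding a_def b_def c_def G3_def by (simp add: G.ppart_gcomm)
  then show ?thesis
    using G3.card_carrier G3.nilpotency_class_eq G3.ord_A G3.ord_B G3.ord_C by simp
qed

end
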